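(* Let $d\ge2$ be an integer and let $\psi=(\psi(\tau_1,\dots,\tau_d))_{(\tau_1,\dots,\tau_d)\in\Theta^d}$ be a symmetric, $d$-admissible, $p$-integrable family (symmetric: $\psi(\tau_1,\dots,\tau_d)=\psi(\tau_{\sigma(1)},\dots,\tau_{\sigma(d)})$ for every permutation $\sigma$ of $\{1,\dots,d\}$). For $S\in\Theta$ set $$V(S)=\operatorname*{ess\,sup}_{(\tau_1,\dots,\tau_d)\in\Theta_S^d}\rho_{S,\tau_1\vee\dots\vee\tau_d}[\psi(\tau_1,\dots,\tau_d)],$$ and assume $V(S)\in L^p$ for each $S\in\Theta$. Let $S\in\Theta$ and, for $i\ge1$, let $\mathcal O_S^i=\{(\tau_1,\dots,\tau_i)\in\Theta_S^i:\tau_1\le\dots\le\tau_i\}$. Define, for $(S_1,\dots,S_{d-1})\in\mathcal O_S^{d-1}$, $$\phi_{d-1}(S_1,\dots,S_{d-1})=\operatorname*{ess\,sup}_{\tau\in\Theta_{S_{d-1}}}\rho_{S_{d-1},\tau}[\psi(S_1,\dots,S_{d-1},\tau)],$$ and, by backward induction for $i\in\{d-2,\dots,1\}$ and $(S_1,\dots,S_i)\in\mathcal O_S^i$, $$\phi_i(S_1,\dots,S_i)=\operatorname*{ess\,sup}_{\tau\in\Theta_{S_i}}\rho_{S_i,\tau}[\phi_{i+1}(S_1,\dots,S_i,\tau)].$$ Then $$V(S)=\operatorname*{ess\,sup}_{\tau\in\Theta_S}\rho_{S,\tau}[\phi_1(\tau)].$$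
   Context: Let $T>0$ be fixed and let $(\Omega,\mathcal F,P)$ be a complete probability space with a right-continuous complete filtration $(\mathcal F_t)_{t\in[0,T]}$. Equalities and inequalities between random variables, and equalities between measurable sets, are understood $P$-a.s. Let $(\theta_k)_{k\in\mathbb N}$ be a sequence of stopping times with $\theta_0=0$, $\theta_k\le\theta_{k+1}$ a.s. for all $k$, and $\lim_k\theta_k=T$ a.s. $\Theta$ (Bermudan stopping strategies) is the set of stopping times of the form $\tau=\sum_{k\ge0}\theta_k\mathbf 1_{A_k}+T\mathbf 1_{\bar A}$, where $\{(A_k)_{k\ge 0},\bar A\}$ is a partition of $\Omega$ with $A_k\in\mathcal F_{\theta_k}$ and $\bar A\in\mathcal F_T$. For $S\in\Theta$, $\Theta_S=\{\nu\in\Theta:\nu\ge S\text{ a.s.}\}$. Fix $p\in[1,+\infty]$. A family $\xi=(\xi(\tau))_{\tau\in\Theta}$ of real random variables is admissible if $\xi(\tau)$ is $\mathcal F_\tau$-measurable and $\xi(\tau)=\xi(\tau')$ a.s. on $\{\tau=\tau'\}$ for all $\tau,\tau'\in\Theta$; it is $p$-integrable if each $\xi(\tau)\in L^p$. A family $(\psi(\tau_1,\dots,\tau_d))_{(\tau_1,\dots,\tau_d)\in\Theta^d}$ is $d$-admissible if $\psi(\tau_1,\dots,\tau_d)$ is $\mathcal F_{\tau_1\vee\dots\vee\tau_d}$-measurable and $\psi(\tau_1,\dots,\tau_d)=\psi(\tilde\tau_1,\dots,\tilde\tau_d)$ on $\bigcap_i\{\tau_i=\tilde\tau_i\}$; it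 is $p$-integrable if each $\psi(\tau_1,\dots,\tau_d)\in L^p$. Bi-admissible means $2$-admissible. The operators $\rho_{S,\tau}$, $S,\tau\in\Theta$, satisfy: (i) $\rho_{S,\tau}:L^p(\mathcal F_\tau)\to L^p(\mathcal F_S)$. (ii) (admissibility) $\rho_{S,\tau}[\eta]=\rho_{S',\tau}[\eta]$ a.s. on $\{S=S'\}$. (iii) (knowledge preservation) $\rho_{\tau,S}[\eta]=\eta$ for all $\eta\in L^p(\mathcal F_S)$, $\tau\in\Theta_S$. (iv) (monotonicity) $\rho_{S,\tau}[\eta_1]\le\rho_{S,\tau}[\eta_2]$ if $\eta_1\le\eta_2$ a.s. (v) (consistency) $\rho_{S,\theta}[\rho_{\theta,\tau}[\eta]]=\rho_{S,\tau}[\eta]$ for $S\le\theta\le\tau$ in $\Theta$, $\eta\in L^p(\mathcal F_\tau)$. (vi) (generalized zero-one law) $\mathbf 1_A\rho_{S,\tau}[\xi(\tau)]=\mathbf 1_A\rho_{S,\tau'}[\xi(\tau')]$ for every admissible $p$-integrable family $\xi$, $A\in\mathcal F_S$, $\tau,\tau'\in\Theta_S$ with $\tau=\tau'$ on $A$. (vi bis) For every bi-admissible $p$-integrable family $\chi$ and all Bermudan stopping times: $\mathbf 1_{\{\tau_1=\tau_1'\}}\rho_{\tau_1,\tau_1\vee\tau_2}[\chi(\tau_1,\tau_2)]=\mathbf 1_{\{\tau_1=\tau_1'\}}\rho_{\tau_1',\tau_1'\vee\tau_2}[\chi(\tau_1',\tau_2)]$ and $\mathbf 1_{\{\tau_2=\tau_2'\}}\rho_{\tau_2,\tau_1\vee\tau_2}[\chi(\tau_1,\tau_2)]=\mathbf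 1_{\{\tau_2=\tau_2'\}}\rho_{\tau_2',\tau_1\vee\tau_2'}[\chi(\tau_1,\tau_2')]$. (vi ter) For every bi-admissible $p$-integrable family $\chi$, all $\tau_1,\tau_2\in\Theta$ and $A\in\mathcal F_{\tau_1\wedge\tau_2}$ such that $\tau_1\wedge\tau_2=\tau_1$ and $\tau_1\vee\tau_2=\tau_2$ a.s. on $A$: $\mathbf 1_A\rho_{\tau_1\wedge\tau_2,\tau_1\vee\tau_2}[\chi(\tau_1\wedge\tau_2,\tau_1\vee\tau_2)]=\mathbf 1_A\rho_{\tau_1\wedge\tau_2,\tau_1\vee\tau_2}[\chi(\tau_1,\tau_2)]=\mathbf 1_A\rho_{\tau_1,\tau_1\vee\tau_2}[\chi(\tau_1,\tau_2)]$, and $\mathbf 1_A\rho_{\tau_1\wedge\tau_2,\tau_1\vee\tau_2}[\chi(\tau_1\vee\tau_2,\tau_1\wedge\tau_2)]=\mathbf 1_A\rho_{\tau_1\wedge\tau_2,\tau_1\vee\tau_2}[\chi(\tau_2,\tau_1)]=\mathbf 1_A\rho_{\tau_1,\tau_1\vee\tau_2}[\chi(\tau_2,\tau_1)]$. (vii) (monotone Fatou property) $\rho_{S,\tau}[\eta]\le\liminf_n\rho_{S,\tau}[\eta_n]$ whenever $(\eta_n)\subset L^p(\mathcal F_\tau)$ is non-decreasing, $\sup_n\eta_n\in L^p$ and $\eta_n\uparrow\eta$ a.s. ($d$-property) For every $d$-admissible $p$-integrable family $\chi$, all $(\tau_1,\dots,\tau_d),(\tau_1',\dots,\tau_d')\in\Theta^d$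 and $A\in\mathcal F_{\tau_1\wedge\dots\wedge\tau_d}$ with $\tau_i=\tau_i'$ on $A$ for all $i$: $\mathbf 1_A\rho_{\tau_1\wedge\dots\wedge\tau_d,\tau_1\vee\dots\vee\tau_d}[\chi(\tau_1,\dots,\tau_d)]=\mathbf 1_A\rho_{\tau_1'\wedge\dots\wedge\tau_d',\tau_1'\vee\dots\vee\tau_d'}[\chi(\tau_1',\dots,\tau_d')]$. For the backward recursion to be meaningful, it is understood that the random variables $\phi_i(S_1,\dots,S_i)$, $1\le i\le d-1$, belong to $L^p$ (so that the operators $\rho$ can be applied to them). *)

theory Defs
  imports "HOL-Probability.Probability" "HOL-Combinatorics.List_Permutation"
begin

section \<open>Filtrations on a finite horizon\<close>

text \<open>
  A filtration on the time interval \<open>[0, T]\<close> is a family \<open>F t\<close> of which only the members with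
  \<open>t \<in> {0..T}\<close> are relevant. The library notions of stopping time and of the sigma-algebra of a
  stopping time quantify over the whole index type, so they are applied to the constant extension
  of \<open>F\<close> beyond both ends of the interval. For times with values in \<open>[0, T]\<close> the extension adds no
  condition, see \<open>horizon_stopping_time_iff\<close> and \<open>sets_stopped_iff\<close> below.
\<close>

definition ext_filtration :: "real \<Rightarrow> (real \<Rightarrow> 'a measure) \<Rightarrow> real \<Rightarrow> 'a measure" where
  "ext_filtration T F t = F (max 0 (min T t))"

locale horizon_filtration = prob_space M + complete_measure M for M :: "'a measure" +
  fixes T :: real and F :: "real \<Rightarrow> 'a measure"
  assumes horizon_pos: "0 < T"
    and subalgebra_F: "\<And>t. t \<in> {0..T} \<Longrightarrow> subalgebra M (F t)"
    and mono_F: "\<And>s t. \<lbrakk>0 \<le> s; s \<le> t; t \<le> T\<rbrakk> \<Longrightarrow> sets (F s) \<subseteq> sets (F t)"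
    and right_continuous_F: "\<And>t. t \<in> {0..<T} \<Longrightarrow> sets (F t) = (\<Inter>s\<in>{t<..T}. sets (F s))"
    and complete_F: "null_sets M \<subseteq> sets (F 0)"

sublocale horizon_filtration \<subseteq> filt: filtration "space M" "ext_filtration T F"
proof
  have cl: "max 0 (min T i) \<in> {0..T}" for i
    using horizon_pos by auto
  show "space (ext_filtration T F i) = space M" for i
    using subalgebra_F[OF cl] by (simp add: ext_filtration_def subalgebra_def)
  show "sets (ext_filtration T F i) \<subseteq> sets (ext_filtration T F j)" if "i \<le> j" for i j
    using cl that unfolding ext_filtration_def by (intro mono_F) auto
qed

definition horizon_stopping_time ::
    "'a measure \<Rightarrow> real \<Rightarrow> (real \<Rightarrow> 'a measure) \<Rightarrow> ('a \<Rightarrow> real) \<Rightarrow> bool" where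
  "horizon_stopping_time M T F \<tau> \<longleftrightarrow>
     stopping_time (ext_filtration T F) \<tau> \<and> (\<forall>\<omega>\<in>space M. \<tau> \<omega> \<in> {0..T})"

definition stopped ::
    "'a measure \<Rightarrow> real \<Rightarrow> (real \<Rightarrow> 'a measure) \<Rightarrow> ('a \<Rightarrow> real) \<Rightarrow> 'a measure" where
  "stopped M T F \<tau> = filtration.pre_sigma (space M) (ext_filtration T F) \<tau>"

lemma (in horizon_filtration) horizon_stopping_time_iff:
  "horizon_stopping_time M T F \<tau> \<longleftrightarrow>
     (\<forall>t\<in>{0..T}. {\<omega>\<in>space M. \<tau> \<omega> \<le> t} \<in> sets (F t)) \<and> (\<forall>\<omega>\<in>space M. \<tau> \<omega> \<in> {0..T})"
proof (cases "\<forall>\<omega>\<in>space M. \<tau> \<omega> \<in> {0..T}")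
  case True
  have "{\<omega>\<in>space M. \<tau> \<omega> \<le> t} \<in> sets (F (max 0 (min T t)))"
    if H: "\<forall>t\<in>{0..T}. {\<omega>\<in>space M. \<tau> \<omega> \<le> t} \<in> sets (F t)" for t
  proof (cases "t < 0")
    case t: True
    then have "{\<omega>\<in>space M. \<tau> \<omega> \<le> t} = {}" using True by fastforce
    then show ?thesis by (simp only: sets.empty_sets)
  next
    case t: False
    then have "{\<omega>\<in>space M. \<tau> \<omega> \<le> t} = {\<omega>\<in>space M. \<tau> \<omega> \<le> max 0 (min T t)}"
      using True by fastforce
    then show ?thesis using H horizon_pos by simp
  qed
  moreover have "{\<omega>\<in>space M. \<tau> \<omega> \<le> t} \<in> sets (F t)" 
    if "\<forall>t. {\<omega>\<in>space M. \<tau> \<omega> \<le> t} \<in> sets (F (max 0 (min T t)))" "t \<in> {0..T}" for t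
    using that(1)[rule_format, of t] that(2) by simp
  ultimately show ?thesis
    using True unfolding horizon_stopping_time_def stopping_time_def pred_def filt.space_F
    unfolding ext_filtration_def by blast
qed (auto simp: horizon_stopping_time_def)

lemma (in horizon_filtration) sets_stopped_iff:
  assumes "horizon_stopping_time M T F \<tau>"
  shows "A \<in> sets (stopped M T F \<tau>) \<longleftrightarrow>
     A \<subseteq> space M \<and> (\<forall>t\<in>{0..T}. {\<omega>\<in>A. \<tau> \<omega> \<le> t} \<in> sets (F t))"
proof -
  have st: "stopping_time (ext_filtration T F) \<tau>" and rng: "\<forall>\<omega>\<in>space M. \<tau> \<omega> \<in> {0..T}"
    using assms by (auto simp: horizon_stopping_time_def)
  have eq: "A \<in> sets (stopped M T F \<tau>) \<longleftrightarrow>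
      (\<forall>t. {\<omega>\<in>A. \<tau> \<omega> \<le> t} \<in> sets (F (max 0 (min T t))))"
    unfolding stopped_def filt.sets_pre_sigma[OF st] by (simp add: ext_filtration_def)
  show ?thesis
  proof
    assume A: "A \<in> sets (stopped M T F \<tau>)"
    then have "A \<subseteq> space M"
      using sets.sets_into_space[OF A] by (simp add: stopped_def filt.space_pre_sigma)
    moreover have "{\<omega>\<in>A. \<tau> \<omega> \<le> t} \<in> sets (F t)" if "t \<in> {0..T}" for t
      using A[unfolded eq, rule_format, of t] that by simp
    ultimately show "A \<subseteq> space M \<and> (\<forall>t\<in>{0..T}. {\<omega>\<in>A. \<tau> \<omega> \<le> t} \<in> sets (F t))" by blast
  next
    assume R: "A \<subseteq> space M \<and> (\<forall>t\<in>{0..T}. {\<omega>\<in>A. \<tau> \<omega> \<le> t} \<in> sets (F t))"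
    show "A \<in> sets (stopped M T F \<tau>)"
      unfolding eq
    proof
      fix t
      show "{\<omega>\<in>A. \<tau> \<omega> \<le> t} \<in> sets (F (max 0 (min T t)))"
      proof (cases "t < 0")
        case True
        then have "{\<omega>\<in>A. \<tau> \<omega> \<le> t} = {}" using R rng by fastforce
        then show ?thesis by (simp only: sets.empty_sets)
      next
        case False
        then have "{\<omega>\<in>A. \<tau> \<omega> \<le> t} = {\<omega>\<in>A. \<tau> \<omega> \<le> max 0 (min T t)}"
          using R rng by fastforce
        then show ?thesis using R horizon_pos by simp
      qed
    qed
  qed
qed


section \<open>Bermudan stopping strategies\<close>

text \<open>Random variables are represented by functions, and all equalities and inequalities between
  them are almost sure. In particular the set of strategies is closed under almost sure equality.\<close>

definition strategies ::
    "'a measure \<Rightarrow> real \<Rightarrow> (real \<Rightarrow> 'a measure) \<Rightarrow> (nat \<Rightarrow> 'a \<Rightarrow> real) \<Rightarrow> ('a \<Rightarrow> real) set" where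
  "strategies M T F \<theta> = {\<tau>. horizon_stopping_time M T F \<tau> \<and>
     (\<exists>A Abar. (\<forall>k. A k \<in> sets (stopped M T F (\<theta> k))) \<and> Abar \<in> sets (F T) \<and>
        disjoint_family A \<and> (\<forall>k. A k \<inter> Abar = {}) \<and> (\<Union>k. A k) \<union> Abar = space M \<and>
        (AE \<omega> in M. \<tau> \<omega> = (\<Sum>k. \<theta> k \<omega> * indicator (A k) \<omega>) + T * indicator Abar \<omega>))}"

definition strategies_from ::
    "'a measure \<Rightarrow> ('a \<Rightarrow> real) set \<Rightarrow> ('a \<Rightarrow> real) \<Rightarrow> ('a \<Rightarrow> real) set" where
  "strategies_from M \<Theta> S = {\<nu>\<in>\<Theta>. AE \<omega> in M. S \<omega> \<le> \<nu> \<omega>}"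

locale bermudan_setting = horizon_filtration M T F
  for M :: "'a measure" and T F +
  fixes \<theta> :: "nat \<Rightarrow> 'a \<Rightarrow> real"
  assumes stopping_time_\<theta>: "\<And>k. horizon_stopping_time M T F (\<theta> k)"
    and \<theta>_0: "AE \<omega> in M. \<theta> 0 \<omega> = 0"
    and \<theta>_mono: "\<And>k. AE \<omega> in M. \<theta> k \<omega> \<le> \<theta> (Suc k) \<omega>"
    and \<theta>_lim: "AE \<omega> in M. (\<lambda>k. \<theta> k \<omega>) \<longlonglongrightarrow> T"

text \<open>Tuples \<open>(\<tau>\<^sub>1, \<dots>, \<tau>\<^sub>d)\<close> are lists of length \<open>d\<close>.\<close>

definition tuples :: "nat \<Rightarrow> 'b set \<Rightarrow> 'b list set" where
  "tuples d \<Theta> = {\<tau>s. length \<tau>s = d \<and> set \<tau>s \<subseteq> \<Theta>}"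

definition ordered_tuples ::
    "'a measure \<Rightarrow> nat \<Rightarrow> ('a \<Rightarrow> real) set \<Rightarrow> ('a \<Rightarrow> real) list set" where
  "ordered_tuples M i \<Theta> =
     {\<tau>s \<in> tuples i \<Theta>. sorted_wrt (\<lambda>\<sigma> \<tau>. AE \<omega> in M. \<sigma> \<omega> \<le> \<tau> \<omega>) \<tau>s}"

definition latest :: "('a \<Rightarrow> real) list \<Rightarrow> 'a \<Rightarrow> real" where
  "latest \<tau>s \<omega> = Max ((\<lambda>\<tau>. \<tau> \<omega>) ` set \<tau>s)"

definition earliest :: "('a \<Rightarrow> real) list \<Rightarrow> 'a \<Rightarrow> real" where
  "earliest \<tau>s \<omega> = Min ((\<lambda>\<tau>. \<tau> \<omega>) ` set \<tau>s)"


section \<open>Integrability and admissible families\<close>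

text \<open>\<open>Lp M p N\<close> is the space of (representatives of) \<open>N\<close>-measurable elements of \<open>L\<^sup>p(M)\<close>, for a
  subalgebra \<open>N\<close> of \<open>M\<close> and \<open>p \<in> [1, \<infinity>]\<close>.\<close>

definition Lp :: "'a measure \<Rightarrow> ennreal \<Rightarrow> 'a measure \<Rightarrow> ('a \<Rightarrow> real) set" where
  "Lp M p N = {f \<in> borel_measurable N.
     if p = \<infinity> then esssup M (\<lambda>\<omega>. ereal \<bar>f \<omega>\<bar>) < \<infinity>
     else integrable M (\<lambda>\<omega>. \<bar>f \<omega>\<bar> powr enn2real p)}"

definition in_Lp_ereal :: "'a measure \<Rightarrow> ennreal \<Rightarrow> ('a \<Rightarrow> ereal) \<Rightarrow> bool" where
  "in_Lp_ereal M p f \<longleftrightarrow>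
     (AE \<omega> in M. \<bar>f \<omega>\<bar> \<noteq> \<infinity>) \<and> (\<lambda>\<omega>. real_of_ereal (f \<omega>)) \<in> Lp M p M"

definition admissible ::
    "'a measure \<Rightarrow> real \<Rightarrow> (real \<Rightarrow> 'a measure) \<Rightarrow> (nat \<Rightarrow> 'a \<Rightarrow> real) \<Rightarrow>
     (('a \<Rightarrow> real) \<Rightarrow> ('a \<Rightarrow> real)) \<Rightarrow> bool" where
  "admissible M T F \<theta> \<xi> \<longleftrightarrow>
     (\<forall>\<tau>\<in>strategies M T F \<theta>. \<xi> \<tau> \<in> borel_measurable (stopped M T F \<tau>)) \<and>
     (\<forall>\<tau>\<in>strategies M T F \<theta>. \<forall>\<tau>'\<in>strategies M T F \<theta>.
        AE \<omega> in M. \<tau> \<omega> = \<tau>' \<omega> \<longrightarrow> \<xi> \<tau> \<omega> = \<xi> \<tau>' \<omega>)"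

definition p_integrable ::
    "'a measure \<Rightarrow> ennreal \<Rightarrow> 'b set \<Rightarrow> ('b \<Rightarrow> ('a \<Rightarrow> real)) \<Rightarrow> bool" where
  "p_integrable M p I \<xi> \<longleftrightarrow> (\<forall>i\<in>I. \<xi> i \<in> Lp M p M)"

definition multi_admissible ::
    "'a measure \<Rightarrow> real \<Rightarrow> (real \<Rightarrow> 'a measure) \<Rightarrow> (nat \<Rightarrow> 'a \<Rightarrow> real) \<Rightarrow> nat \<Rightarrow>
     (('a \<Rightarrow> real) list \<Rightarrow> ('a \<Rightarrow> real)) \<Rightarrow> bool" where
  "multi_admissible M T F \<theta> d \<psi> \<longleftrightarrow>
     (\<forall>\<tau>s\<in>tuples d (strategies M T F \<theta>).
        \<psi> \<tau>s \<in> borel_measurable (stopped M T F (latest \<tau>s))) \<and>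
     (\<forall>\<tau>s\<in>tuples d (strategies M T F \<theta>). \<forall>\<sigma>s\<in>tuples d (strategies M T F \<theta>).
        AE \<omega> in M. (\<forall>i<d. (\<tau>s ! i) \<omega> = (\<sigma>s ! i) \<omega>) \<longrightarrow> \<psi> \<tau>s \<omega> = \<psi> \<sigma>s \<omega>)"

definition symmetric_family ::
    "'a measure \<Rightarrow> ('a \<Rightarrow> real) set \<Rightarrow> nat \<Rightarrow> (('a \<Rightarrow> real) list \<Rightarrow> ('a \<Rightarrow> real)) \<Rightarrow> bool" where
  "symmetric_family M \<Theta> d \<psi> \<longleftrightarrow>
     (\<forall>\<tau>s\<in>tuples d \<Theta>. \<forall>\<pi>. \<pi> permutes {..<d} \<longrightarrow>
        (AE \<omega> in M. \<psi> \<tau>s \<omega> = \<psi> (permute_list \<pi> \<tau>s) \<omega>))"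


section \<open>The operators\<close>

text \<open>\<open>\<rho> S \<tau>\<close> acts on representatives; by \<open>monotonicity\<close> it respects almost sure equality.
  On functions, \<open>sup\<close> and \<open>inf\<close> are the pointwise maximum and minimum.
  In \<open>monotone_fatou\<close> the limit \<open>\<eta>\<close> is almost surely \<open>sup\<^sub>n \<eta>s n\<close>, so \<open>\<eta> \<in> Lp\<close> is the requirement that
  this supremum be in \<open>L\<^sup>p\<close>. The number \<open>d\<close> is only used in \<open>d_law\<close>.\<close>

locale bermudan_operators = bermudan_setting M T F \<theta>
  for M :: "'a measure" and T F \<theta> +
  fixes p :: ennreal
    and d :: nat
    and \<rho> :: "('a \<Rightarrow> real) \<Rightarrow> ('a \<Rightarrow> real) \<Rightarrow> ('a \<Rightarrow> real) \<Rightarrow> ('a \<Rightarrow> real)"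
  assumes p_ge_1: "1 \<le> p"
    and maps_Lp: "\<And>S \<tau> \<eta>. \<lbrakk>S \<in> strategies M T F \<theta>; \<tau> \<in> strategies M T F \<theta>;
        \<eta> \<in> Lp M p (stopped M T F \<tau>)\<rbrakk> \<Longrightarrow> \<rho> S \<tau> \<eta> \<in> Lp M p (stopped M T F S)"
    and admissibility: "\<And>S S' \<tau> \<eta>. \<lbrakk>S \<in> strategies M T F \<theta>; S' \<in> strategies M T F \<theta>;
        \<tau> \<in> strategies M T F \<theta>; \<eta> \<in> Lp M p (stopped M T F \<tau>)\<rbrakk> \<Longrightarrow>
        AE \<omega> in M. S \<omega> = S' \<omega> \<longrightarrow> \<rho> S \<tau> \<eta> \<omega> = \<rho> S' \<tau> \<eta> \<omega>"
    and knowledge_preservation: "\<And>S \<tau> \<eta>. \<lbrakk>S \<in> strategies M T F \<theta>;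
        \<tau> \<in> strategies_from M (strategies M T F \<theta>) S; \<eta> \<in> Lp M p (stopped M T F S)\<rbrakk> \<Longrightarrow>
        AE \<omega> in M. \<rho> \<tau> S \<eta> \<omega> = \<eta> \<omega>"
    and monotonicity: "\<And>S \<tau> \<eta>\<^sub>1 \<eta>\<^sub>2. \<lbrakk>S \<in> strategies M T F \<theta>; \<tau> \<in> strategies M T F \<theta>;
        \<eta>\<^sub>1 \<in> Lp M p (stopped M T F \<tau>); \<eta>\<^sub>2 \<in> Lp M p (stopped M T F \<tau>);
        AE \<omega> in M. \<eta>\<^sub>1 \<omega> \<le> \<eta>\<^sub>2 \<omega>\<rbrakk> \<Longrightarrow> AE \<omega> in M. \<rho> S \<tau> \<eta>\<^sub>1 \<omega> \<le> \<rho> S \<tau> \<eta>\<^sub>2 \<omega>"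
    and consistency: "\<And>S \<nu> \<tau> \<eta>. \<lbrakk>S \<in> strategies M T F \<theta>; \<nu> \<in> strategies M T F \<theta>;
        \<tau> \<in> strategies M T F \<theta>; AE \<omega> in M. S \<omega> \<le> \<nu> \<omega>; AE \<omega> in M. \<nu> \<omega> \<le> \<tau> \<omega>;
        \<eta> \<in> Lp M p (stopped M T F \<tau>)\<rbrakk> \<Longrightarrow>
        AE \<omega> in M. \<rho> S \<nu> (\<rho> \<nu> \<tau> \<eta>) \<omega> = \<rho> S \<tau> \<eta> \<omega>"
    and zero_one_law: "\<And>\<xi> S A \<tau> \<tau>'. \<lbrakk>admissible M T F \<theta> \<xi>;
        p_integrable M p (strategies M T F \<theta>) \<xi>;
        S \<in> strategies M T F \<theta>; A \<in> sets (stopped M T F S);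
        \<tau> \<in> strategies_from M (strategies M T F \<theta>) S;
        \<tau>' \<in> strategies_from M (strategies M T F \<theta>) S;
        AE \<omega> in M. \<omega> \<in> A \<longrightarrow> \<tau> \<omega> = \<tau>' \<omega>\<rbrakk> \<Longrightarrow>
        AE \<omega> in M. \<omega> \<in> A \<longrightarrow> \<rho> S \<tau> (\<xi> \<tau>) \<omega> = \<rho> S \<tau>' (\<xi> \<tau>') \<omega>"
    and bi_law_1: "\<And>X \<sigma> \<sigma>' \<tau>. \<lbrakk>multi_admissible M T F \<theta> 2 X;
        p_integrable M p (tuples 2 (strategies M T F \<theta>)) X;
        \<sigma> \<in> strategies M T F \<theta>; \<sigma>' \<in> strategies M T F \<theta>; \<tau> \<in> strategies M T F \<theta>\<rbrakk> \<Longrightarrow>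
        AE \<omega> in M. \<sigma> \<omega> = \<sigma>' \<omega> \<longrightarrow>
          \<rho> \<sigma> (sup \<sigma> \<tau>) (X [\<sigma>, \<tau>]) \<omega> = \<rho> \<sigma>' (sup \<sigma>' \<tau>) (X [\<sigma>', \<tau>]) \<omega>"
    and bi_law_2: "\<And>X \<sigma> \<tau> \<tau>'. \<lbrakk>multi_admissible M T F \<theta> 2 X;
        p_integrable M p (tuples 2 (strategies M T F \<theta>)) X;
        \<sigma> \<in> strategies M T F \<theta>; \<tau> \<in> strategies M T F \<theta>; \<tau>' \<in> strategies M T F \<theta>\<rbrakk> \<Longrightarrow>
        AE \<omega> in M. \<tau> \<omega> = \<tau>' \<omega> \<longrightarrow>
          \<rho> \<tau> (sup \<sigma> \<tau>) (X [\<sigma>, \<tau>]) \<omega> = \<rho> \<tau>' (sup \<sigma> \<tau>') (X [\<sigma>, \<tau>']) \<omega>"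
    and bi_order_law: "\<And>X \<sigma> \<tau> A. \<lbrakk>multi_admissible M T F \<theta> 2 X;
        p_integrable M p (tuples 2 (strategies M T F \<theta>)) X;
        \<sigma> \<in> strategies M T F \<theta>; \<tau> \<in> strategies M T F \<theta>;
        A \<in> sets (stopped M T F (inf \<sigma> \<tau>));
        AE \<omega> in M. \<omega> \<in> A \<longrightarrow> inf \<sigma> \<tau> \<omega> = \<sigma> \<omega> \<and> sup \<sigma> \<tau> \<omega> = \<tau> \<omega>\<rbrakk> \<Longrightarrow>
        AE \<omega> in M. \<omega> \<in> A \<longrightarrow>
          \<rho> (inf \<sigma> \<tau>) (sup \<sigma> \<tau>) (X [inf \<sigma> \<tau>, sup \<sigma> \<tau>]) \<omega>
            = \<rho> (inf \<sigma> \<tau>) (sup \<sigma> \<tau>) (X [\<sigma>, \<tau>]) \<omega> \<and>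
          \<rho> (inf \<sigma> \<tau>) (sup \<sigma> \<tau>) (X [\<sigma>, \<tau>]) \<omega>
            = \<rho> \<sigma> (sup \<sigma> \<tau>) (X [\<sigma>, \<tau>]) \<omega> \<and>
          \<rho> (inf \<sigma> \<tau>) (sup \<sigma> \<tau>) (X [sup \<sigma> \<tau>, inf \<sigma> \<tau>]) \<omega>
            = \<rho> (inf \<sigma> \<tau>) (sup \<sigma> \<tau>) (X [\<tau>, \<sigma>]) \<omega> \<and>
          \<rho> (inf \<sigma> \<tau>) (sup \<sigma> \<tau>) (X [\<tau>, \<sigma>]) \<omega>
            = \<rho> \<sigma> (sup \<sigma> \<tau>) (X [\<tau>, \<sigma>]) \<omega>"
    and monotone_fatou: "\<And>S \<tau> \<eta> \<eta>s. \<lbrakk>S \<in> strategies M T F \<theta>; \<tau> \<in> strategies M T F \<theta>;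
        \<And>n. \<eta>s n \<in> Lp M p (stopped M T F \<tau>); \<And>n. AE \<omega> in M. \<eta>s n \<omega> \<le> \<eta>s (Suc n) \<omega>;
        \<eta> \<in> Lp M p (stopped M T F \<tau>); AE \<omega> in M. (\<lambda>n. \<eta>s n \<omega>) \<longlonglongrightarrow> \<eta> \<omega>\<rbrakk> \<Longrightarrow>
        AE \<omega> in M. ereal (\<rho> S \<tau> \<eta> \<omega>) \<le> liminf (\<lambda>n. ereal (\<rho> S \<tau> (\<eta>s n) \<omega>))"
    and d_law: "\<And>X \<tau>s \<tau>s' A. \<lbrakk>multi_admissible M T F \<theta> d X;
        p_integrable M p (tuples d (strategies M T F \<theta>)) X;
        \<tau>s \<in> tuples d (strategies M T F \<theta>); \<tau>s' \<in> tuples d (strategies M T F \<theta>);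
        A \<in> sets (stopped M T F (earliest \<tau>s));
        \<And>i. i < d \<Longrightarrow> AE \<omega> in M. \<omega> \<in> A \<longrightarrow> (\<tau>s ! i) \<omega> = (\<tau>s' ! i) \<omega>\<rbrakk> \<Longrightarrow>
        AE \<omega> in M. \<omega> \<in> A \<longrightarrow>
          \<rho> (earliest \<tau>s) (latest \<tau>s) (X \<tau>s) \<omega> = \<rho> (earliest \<tau>s') (latest \<tau>s') (X \<tau>s') \<omega>"


section \<open>Essential supremum of a family of random variables\<close>

text \<open>The library's \<^const>\<open>esssup\<close> is the essential supremum of a single function. For a
  family of random variables it is the almost surely least random variable, with values in the
  extended reals, that dominates each member almost surely. It exists for every family of random
  variables, and is almost surely unique; \<open>ess_SUP\<close> picks a representative.\<close>

definition is_ess_SUP ::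
    "'a measure \<Rightarrow> 'b set \<Rightarrow> ('b \<Rightarrow> 'a \<Rightarrow> real) \<Rightarrow> ('a \<Rightarrow> ereal) \<Rightarrow> bool" where
  "is_ess_SUP M I X f \<longleftrightarrow> f \<in> borel_measurable M \<and>
     (\<forall>i\<in>I. AE \<omega> in M. ereal (X i \<omega>) \<le> f \<omega>) \<and>
     (\<forall>g\<in>borel_measurable M. (\<forall>i\<in>I. AE \<omega> in M. ereal (X i \<omega>) \<le> g \<omega>) \<longrightarrow>
        (AE \<omega> in M. f \<omega> \<le> g \<omega>))"

definition ess_SUP ::
    "'a measure \<Rightarrow> 'b set \<Rightarrow> ('b \<Rightarrow> 'a \<Rightarrow> real) \<Rightarrow> 'a \<Rightarrow> ereal" where
  "ess_SUP M I X = (SOME f. is_ess_SUP M I X f)"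

lemma is_ess_SUP_unique:
  assumes "is_ess_SUP M I X f" "is_ess_SUP M I X g"
  shows "AE \<omega> in M. f \<omega> = g \<omega>"
proof -
  have "AE \<omega> in M. f \<omega> \<le> g \<omega>" "AE \<omega> in M. g \<omega> \<le> f \<omega>"
    using assms unfolding is_ess_SUP_def by blast+
  then show ?thesis by eventually_elim auto
qed

text \<open>The essential supremum is attained as the supremum of a countable subfamily.\<close>

lemma (in prob_space) ess_SUP_countable:
  fixes X :: "'b \<Rightarrow> 'a \<Rightarrow> real"
  assumes X: "\<And>i. i \<in> I \<Longrightarrow> X i \<in> borel_measurable M"
  obtains J where "countable J" "J \<subseteq> I" "is_ess_SUP M I X (\<lambda>\<omega>. SUP i\<in>J. ereal (X i \<omega>))"
proof -
  define U where "U q J = (\<Union>i\<in>J. {\<omega>\<in>space M. X i \<omega> > q})" for q :: real and J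
  have U_sets: "U q J \<in> events" if "countable J" "J \<subseteq> I" for q J
    unfolding U_def using that X by (intro sets.countable_UN') auto
  have "\<exists>J. countable J \<and> J \<subseteq> I \<and>
      (\<forall>J'. countable J' \<longrightarrow> J' \<subseteq> I \<longrightarrow> prob (U q J') \<le> prob (U q J))" for q
  proof -
    define P where "P = {J. countable J \<and> J \<subseteq> I}"
    define s where "s = (SUP J\<in>P. prob (U q J))"
    have ne: "P \<noteq> {}" unfolding P_def by blast
    have bdd: "bdd_above ((\<lambda>J. prob (U q J)) ` P)" by (intro bdd_aboveI[of _ 1]) auto
    have "\<exists>J\<in>P. s - 1 / Suc n < prob (U q J)" for n
      using less_cSUP_iff[OF ne bdd, of "s - 1 / Suc n"] unfolding s_def by simp
    then obtain J where J: "\<And>n. J n \<in> P" "\<And>n. s - 1 / Suc n < prob (U q (J n))"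
      by metis
    have JP: "(\<Union>n. J n) \<in> P" using J(1) by (auto simp: P_def)
    have "s - 1 / Suc n \<le> prob (U q (\<Union>n. J n))" for n
    proof -
      have "prob (U q (J n)) \<le> prob (U q (\<Union>n. J n))"
        using JP by (intro finite_measure_mono U_sets) (auto simp: U_def P_def)
      then show ?thesis using J(2)[of n] by linarith
    qed
    moreover have "(\<lambda>n. s - 1 / Suc n) \<longlonglongrightarrow> s"
      using tendsto_diff[OF tendsto_const LIMSEQ_Suc[OF lim_1_over_n]] by simp
    ultimately have "s \<le> prob (U q (\<Union>n. J n))"
      by (intro LIMSEQ_le_const2) auto
    moreover have "prob (U q J') \<le> s" if "J' \<in> P" for J'
      unfolding s_def using that bdd by (rule cSUP_upper)
    ultimately show ?thesis using JP by (intro exI[of _ "\<Union>n. J n"]) (force simp: P_def)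
  qed
  then obtain Jq where Jq: "\<And>q. countable (Jq q)" "\<And>q. Jq q \<subseteq> I"
    "\<And>q J'. countable J' \<Longrightarrow> J' \<subseteq> I \<Longrightarrow> prob (U q J') \<le> prob (U q (Jq q))"
    by metis
  define J where "J = (\<Union>q\<in>\<rat>. Jq q)"
  have J: "countable J" "J \<subseteq> I"
    using Jq by (auto simp: J_def countable_rat)
  let ?f = "\<lambda>\<omega>. SUP i\<in>J. ereal (X i \<omega>)"
  have dom: "AE \<omega> in M. ereal (X i \<omega>) \<le> ?f \<omega>" if i: "i \<in> I" for i
  proof -
    have "AE \<omega> in M. \<forall>q\<in>\<rat>. X i \<omega> > q \<longrightarrow> \<omega> \<in> U q (Jq q)"
      unfolding AE_ball_countable[OF countable_rat]
    proof
      fix q :: real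
      let ?A = "{\<omega>\<in>space M. X i \<omega> > q}"
      have A: "?A \<in> events" using X[OF i] by measurable
      have UJ: "U q (Jq q) \<in> events" using U_sets Jq by blast
      have eq: "U q (insert i (Jq q)) = U q (Jq q) \<union> (?A - U q (Jq q))" by (auto simp: U_def)
      have "prob (U q (Jq q)) + prob (?A - U q (Jq q)) = prob (U q (insert i (Jq q)))"
        unfolding eq using A UJ by (subst finite_measure_Union) auto
      also have "\<dots> \<le> prob (U q (Jq q))" using Jq i by (intro Jq(3)) auto
      finally have "prob (?A - U q (Jq q)) = 0"
        using measure_nonneg[of M "?A - U q (Jq q)"] by linarith
      then have "?A - U q (Jq q) \<in> null_sets M"
        using A UJ by (auto simp: null_sets_def emeasure_eq_measure)
      then show "AE \<omega> in M. X i \<omega> > q \<longrightarrow> \<omega> \<in> U q (Jq q)"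
        by (rule AE_I') auto
    qed
    then show ?thesis
    proof eventually_elim
      case (elim \<omega>)
      show ?case
      proof (rule ccontr)
        assume "\<not> ereal (X i \<omega>) \<le> ?f \<omega>"
        then have "?f \<omega> < ereal (X i \<omega>)" by simp
        then obtain r :: real where r: "?f \<omega> < ereal r" "r < X i \<omega>"
          using ereal_dense2 by fastforce
        obtain q where q: "q \<in> \<rat>" "r < q" "q < X i \<omega>" using Rats_dense_in_real[OF r(2)] by blast
        then have "\<omega> \<in> U q (Jq q)" using elim by blast
        then obtain j where j: "j \<in> Jq q" "X j \<omega> > q" by (auto simp: U_def)
        then have "ereal (X j \<omega>) \<le> ?f \<omega>" using q by (intro SUP_upper) (auto simp: J_def)
        then have "ereal (X j \<omega>) < ereal r" using r(1) by (rule le_less_trans)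
        then show False using j q by simp
      qed
    qed
  qed
  have meas: "?f \<in> borel_measurable M"
    using J X by (intro borel_measurable_SUP) auto
  have least: "AE \<omega> in M. ?f \<omega> \<le> g \<omega>" if "\<forall>i\<in>I. AE \<omega> in M. ereal (X i \<omega>) \<le> g \<omega>" for g
  proof -
    have "AE \<omega> in M. \<forall>i\<in>J. ereal (X i \<omega>) \<le> g \<omega>"
      unfolding AE_ball_countable[OF J(1)] using that J(2) by blast
    then show ?thesis by eventually_elim (auto intro: SUP_least)
  qed
  show thesis
    using J dom meas least by (intro that[of J]) (auto simp: is_ess_SUP_def)
qed

lemma (in prob_space) is_ess_SUP_ess_SUP:
  assumes "\<And>i. i \<in> I \<Longrightarrow> X i \<in> borel_measurable M"
  shows "is_ess_SUP M I X (ess_SUP M I X)"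
proof -
  obtain J where "countable J" "J \<subseteq> I" "is_ess_SUP M I X (\<lambda>\<omega>. SUP i\<in>J. ereal (X i \<omega>))"
    by (rule ess_SUP_countable[of I X]) (use assms in auto)
  then show ?thesis unfolding ess_SUP_def by (metis someI)
qed


section \<open>The value function and the backward recursion\<close>

definition value_fun ::
    "'a measure \<Rightarrow> ('a \<Rightarrow> real) set \<Rightarrow>
     (('a \<Rightarrow> real) \<Rightarrow> ('a \<Rightarrow> real) \<Rightarrow> ('a \<Rightarrow> real) \<Rightarrow> ('a \<Rightarrow> real)) \<Rightarrow>
     nat \<Rightarrow> (('a \<Rightarrow> real) list \<Rightarrow> ('a \<Rightarrow> real)) \<Rightarrow> ('a \<Rightarrow> real) \<Rightarrow> 'a \<Rightarrow> ereal" where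
  "value_fun M \<Theta> \<rho> d \<psi> S =
     ess_SUP M (tuples d (strategies_from M \<Theta> S)) (\<lambda>\<tau>s. \<rho> S (latest \<tau>s) (\<psi> \<tau>s))"

text \<open>\<open>phi M \<Theta> \<rho> d \<psi> [S\<^sub>1, \<dots>, S\<^sub>i]\<close> is the reward \<open>\<phi>\<^sub>i(S\<^sub>1, \<dots>, S\<^sub>i)\<close> for \<open>1 \<le> i \<le> d - 1\<close>; the index
  \<open>i\<close> is the length of the tuple. The two cases of the recursion are \<open>phi_last\<close> and \<open>phi_step\<close>.
  The coercion \<^const>\<open>real_of_ereal\<close> is harmless where \<open>\<phi>\<^bsub>i+1\<^esub>\<close> is finite almost surely.\<close>

function phi ::
    "'a measure \<Rightarrow> ('a \<Rightarrow> real) set \<Rightarrow>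
     (('a \<Rightarrow> real) \<Rightarrow> ('a \<Rightarrow> real) \<Rightarrow> ('a \<Rightarrow> real) \<Rightarrow> ('a \<Rightarrow> real)) \<Rightarrow>
     nat \<Rightarrow> (('a \<Rightarrow> real) list \<Rightarrow> ('a \<Rightarrow> real)) \<Rightarrow> ('a \<Rightarrow> real) list \<Rightarrow> 'a \<Rightarrow> ereal" where
  "phi M \<Theta> \<rho> d \<psi> Ss =
     (if length Ss + 1 < d
      then ess_SUP M (strategies_from M \<Theta> (last Ss))
             (\<lambda>\<tau>. \<rho> (last Ss) \<tau> (\<lambda>\<omega>. real_of_ereal (phi M \<Theta> \<rho> d \<psi> (Ss @ [\<tau>]) \<omega>)))
      else ess_SUP M (strategies_from M \<Theta> (last Ss))
             (\<lambda>\<tau>. \<rho> (last Ss) \<tau> (\<psi> (Ss @ [\<tau>]))))"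
  by pat_completeness auto
termination
  by (relation "Wellfounded.measure (\<lambda>(M, \<Theta>, \<rho>, d, \<psi>, Ss). d - length Ss)") auto

declare phi.simps [simp del]

lemma phi_last:
  assumes "d \<ge> 2" "length Ss = d - 1"
  shows "phi M \<Theta> \<rho> d \<psi> Ss =
    ess_SUP M (strategies_from M \<Theta> (last Ss)) (\<lambda>\<tau>. \<rho> (last Ss) \<tau> (\<psi> (Ss @ [\<tau>])))"
  using assms by (subst phi.simps) simp

lemma phi_step:
  assumes "length Ss \<in> {1..d - 2}"
  shows "phi M \<Theta> \<rho> d \<psi> Ss =
    ess_SUP M (strategies_from M \<Theta> (last Ss))
      (\<lambda>\<tau>. \<rho> (last Ss) \<tau> (\<lambda>\<omega>. real_of_ereal (phi M \<Theta> \<rho> d \<psi> (Ss @ [\<tau>]) \<omega>)))"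
  using assms by (subst phi.simps) auto

end

theory Submission
  imports Defs
begin

text \<open>
  An optimal stopping problem with \<open>d\<close> times is solved by stopping once at a time: the first time
  \<open>\<tau>\<close> is paid by \<open>\<phi>\<^sub>1(\<tau>)\<close>, the value of the problem in which \<open>\<tau>\<close> has been used and \<open>d - 1\<close> later times
  are left. Each inequality between the two sides rests on one idea.

  The value is at most the iterated supremum. By symmetry the reward of a tuple is the reward of its
  order statistics \<open>\<tau>\<^sub>1 \<le> \<dots> \<le> \<tau>\<^sub>d\<close>, which are again strategies, because being a strategy only says that
  a stopping time takes its values among \<open>T\<close> and the \<open>\<theta>\<^sub>k\<close> (\<open>strats_iff\<close>). For an ordered tuple,
  consistency splits \<open>\<rho>\<^bsub>S,\<tau>\<^sub>d\<^esub>\<close> into \<open>d\<close> successive evaluations, and monotonicity bounds each of them,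
  from the last one backwards, by the corresponding supremum (\<open>rho_reward_le_first\<close>).

  The iterated supremum is at most the value. Here \<open>\<rho>\<^bsub>S,S\<^sub>i\<^esub>\<close> has to be exchanged with the supremum
  that defines \<open>\<phi>\<^sub>i(S\<^sub>1, \<dots>, S\<^sub>i)\<close>. The family under this supremum is directed: of two continuations \<open>a\<close>
  and \<open>b\<close> follow at time \<open>S\<^sub>i\<close> the one whose evaluation is larger (\<open>gain_directed\<close>). Hence the
  supremum is the limit of an increasing sequence, and the Fatou property applies
  (\<open>rho_reward_le_value\<close>).

  Directedness uses the zero-one law for the family \<open>\<tau> \<mapsto> \<phi>\<^bsub>i+1\<^esub>(S\<^sub>1, \<dots>, S\<^sub>i, \<tau>)\<close>, so this family has to be
  admissible: on the event where two ordered tuples coincide, their rewards must coincide. This is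
  the main difficulty (\<open>phi_mono_on_eq\<close>), since it asks for \<open>\<rho>\<^bsub>S,\<tau>\<^esub>[\<eta>]\<close> to depend, on the given event,
  only on the values of \<open>\<eta>\<close> on that event. The zero-one law does not say this, because members of one
  admissible family agree wherever their times agree, so that it never compares two payoffs at the
  same time that differ off the event. For an event \<open>{S = S*}\<close>, however, one may pass from \<open>S\<close> to \<open>S*\<close>
  with a two-parameter family whose members vanish where \<open>S \<noteq> S*\<close>; after this step the values of \<open>\<eta>\<close>
  off the event are forgotten (\<open>rho_transport\<close>, \<open>local_at_eq\<close>). The event where two ordered tuples
  coincide is a finite intersection of events of this form (\<open>local_at_tuples_eq\<close>).
\<close>

section \<open>Stopping times up to null sets\<close>

context horizon_filtration
begin

abbreviation hst :: "('a \<Rightarrow> real) \<Rightarrow> bool" where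
  "hst \<equiv> horizon_stopping_time M T F"

abbreviation Fs :: "('a \<Rightarrow> real) \<Rightarrow> 'a measure" where
  "Fs \<equiv> stopped M T F"

lemma space_Fs [simp]: "space (Fs \<tau>) = space M"
  by (simp add: stopped_def filt.space_pre_sigma)

text \<open>Null sets are known at time \<open>0\<close>, so a modification on a null set stays in each \<open>F t\<close>. This makes
  all notions below stable under almost sure equality.\<close>

lemma F_AE:
  assumes t: "t \<in> {0..T}" and X: "X \<in> sets (F t)" and Y: "Y \<subseteq> space M"
    and eq: "AE \<omega> in M. \<omega> \<in> X \<longleftrightarrow> \<omega> \<in> Y"
  shows "Y \<in> sets (F t)"
proof -
  obtain N where N: "N \<in> null_sets M" "{\<omega>\<in>space M. \<not> (\<omega> \<in> X \<longleftrightarrow> \<omega> \<in> Y)} \<subseteq> N"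
    using AE_E[OF eq] by (metis null_setsI)
  have sX: "X \<subseteq> space M"
    using X subalgebra_F[OF t] sets.sets_into_space by (fastforce simp: subalgebra_def)
  have null: "Z \<in> sets (F t)" if "Z \<subseteq> N" for Z
  proof -
    have "Z \<in> null_sets M"
      using complete_measure_axioms that N(1) by (metis complete2 null_sets_subset null_setsD2)
    then show ?thesis
      using complete_F mono_F[of 0 t] t by auto
  qed
  have "X - Y \<in> sets (F t)" "Y - X \<in> sets (F t)"
    using N(2) sX Y by (auto intro!: null)
  then have "(X - (X - Y)) \<union> (Y - X) \<in> sets (F t)" using X by blast
  moreover have "(X - (X - Y)) \<union> (Y - X) = Y" by blast
  ultimately show ?thesis by simp
qed

lemma hst_le: "hst \<tau> \<Longrightarrow> t \<in> {0..T} \<Longrightarrow> {\<omega>\<in>space M. \<tau> \<omega> \<le> t} \<in> sets (F t)"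
  by (simp add: horizon_stopping_time_iff)

lemma hst_range: "hst \<tau> \<Longrightarrow> \<omega> \<in> space M \<Longrightarrow> 0 \<le> \<tau> \<omega> \<and> \<tau> \<omega> \<le> T"
  by (simp add: horizon_stopping_time_def)

lemma hst_AE:
  assumes "hst \<tau>" "AE \<omega> in M. \<tau> \<omega> = \<tau>' \<omega>" "\<And>\<omega>. \<omega> \<in> space M \<Longrightarrow> \<tau>' \<omega> \<in> {0..T}"
  shows "hst \<tau>'"
proof -
  have "{\<omega>\<in>space M. \<tau>' \<omega> \<le> t} \<in> sets (F t)" if "t \<in> {0..T}" for t
    by (rule F_AE[OF that hst_le[OF assms(1) that]]) (use assms(2) in auto)
  then show ?thesis using assms(3) by (simp add: horizon_stopping_time_iff)
qed

lemma Fs_mono: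
  assumes \<sigma>: "hst \<sigma>" and \<tau>: "hst \<tau>" and le: "AE \<omega> in M. \<sigma> \<omega> \<le> \<tau> \<omega>"
  shows "sets (Fs \<sigma>) \<subseteq> sets (Fs \<tau>)"
proof
  fix A assume A: "A \<in> sets (Fs \<sigma>)"
  have "{\<omega>\<in>A. \<tau> \<omega> \<le> t} \<in> sets (F t)" if t: "t \<in> {0..T}" for t
  proof (rule F_AE[OF t])
    show "{\<omega>\<in>A. \<sigma> \<omega> \<le> t} \<inter> {\<omega>\<in>space M. \<tau> \<omega> \<le> t} \<in> sets (F t)"
      using A hst_le[OF \<tau> t] t by (auto simp: sets_stopped_iff[OF \<sigma>])
    show "AE \<omega> in M. \<omega> \<in> {\<omega>\<in>A. \<sigma> \<omega> \<le> t} \<inter> {\<omega>\<in>space M. \<tau> \<omega> \<le> t} \<longleftrightarrow> \<omega> \<in> {\<omega>\<in>A. \<tau> \<omega> \<le> t}"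
      using le AE_space by eventually_elim auto
  qed (use A in \<open>auto simp: sets_stopped_iff[OF \<sigma>]\<close>)
  then show "A \<in> sets (Fs \<tau>)"
    using A by (auto simp: sets_stopped_iff[OF \<sigma>] sets_stopped_iff[OF \<tau>])
qed

lemma sets_Fs_subset:
  assumes \<tau>: "hst \<tau>" shows "sets (Fs \<tau>) \<subseteq> sets M"
proof
  fix A assume A: "A \<in> sets (Fs \<tau>)"
  have "{\<omega>\<in>A. \<tau> \<omega> \<le> T} \<in> sets (F T)" "A \<subseteq> space M"
    using A horizon_pos by (auto simp: sets_stopped_iff[OF \<tau>])
  moreover have "{\<omega>\<in>A. \<tau> \<omega> \<le> T} = A"
    using hst_range[OF \<tau>] calculation(2) by auto
  ultimately show "A \<in> sets M"
    using subalgebra_F[of T] horizon_pos by (auto simp: subalgebra_def)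
qed

lemma Fs_into_M:
  "hst \<tau> \<Longrightarrow> f \<in> measurable (Fs \<tau>) N \<Longrightarrow> f \<in> measurable M N"
  using sets_Fs_subset[of \<tau>] by (auto simp: measurable_def)

lemma measurable_Fs_mono:
  assumes "f \<in> measurable (Fs \<sigma>) N" "hst \<sigma>" "hst \<tau>" "AE \<omega> in M. \<sigma> \<omega> \<le> \<tau> \<omega>"
  shows "f \<in> measurable (Fs \<tau>) N"
  using assms Fs_mono[OF assms(2-4)] by (auto simp: measurable_def)

lemma sets_Fs_AE:
  assumes \<tau>: "hst \<tau>" and X: "X \<in> sets (Fs \<tau>)" and Y: "Y \<subseteq> space M"
    and eq: "AE \<omega> in M. \<omega> \<in> X \<longleftrightarrow> \<omega> \<in> Y"
  shows "Y \<in> sets (Fs \<tau>)"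
proof -
  have "{\<omega>\<in>Y. \<tau> \<omega> \<le> t} \<in> sets (F t)" if t: "t \<in> {0..T}" for t
    by (rule F_AE[OF t, of "{\<omega>\<in>X. \<tau> \<omega> \<le> t}"])
      (use X Y t eq in \<open>auto simp: sets_stopped_iff[OF \<tau>]\<close>)
  then show ?thesis using Y by (auto simp: sets_stopped_iff[OF \<tau>])
qed

lemma measurable_Fs_AE:
  assumes \<tau>: "hst \<tau>" and f: "f \<in> borel_measurable (Fs \<tau>)" and eq: "AE \<omega> in M. f \<omega> = g \<omega>"
  shows "g \<in> borel_measurable (Fs \<tau>)"
proof (rule measurableI)
  fix A :: "'b set" assume A: "A \<in> sets borel"
  show "g -` A \<inter> space (Fs \<tau>) \<in> sets (Fs \<tau>)"
    by (rule sets_Fs_AE[OF \<tau> measurable_sets[OF f A]]) (use eq in auto)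
qed auto

lemma hst_min: "hst \<sigma> \<Longrightarrow> hst \<tau> \<Longrightarrow> hst (inf \<sigma> \<tau>)"
  unfolding horizon_stopping_time_def inf_fun_def inf_min
  by (auto intro: stopping_time_min)

lemma hst_max: "hst \<sigma> \<Longrightarrow> hst \<tau> \<Longrightarrow> hst (sup \<sigma> \<tau>)"
  unfolding horizon_stopping_time_def sup_fun_def sup_max
  by (auto intro: stopping_time_max)

lemma hst_const: "c \<in> {0..T} \<Longrightarrow> hst (\<lambda>_. c)"
  by (auto simp: horizon_stopping_time_def stopping_time_const)

text \<open>Comparisons of \<open>\<sigma>\<close> and \<open>\<tau>\<close> are decided at time \<open>\<sigma> \<and> \<tau>\<close>, hence at both times.\<close>

lemma pred_less_Fs:
  assumes \<sigma>: "hst \<sigma>" and \<tau>: "hst \<tau>"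
  shows "Measurable.pred (Fs (inf \<sigma> \<tau>)) (\<lambda>\<omega>. \<sigma> \<omega> < \<tau> \<omega>)"
proof -
  have "Measurable.pred (filt.pre_sigma (inf \<sigma> \<tau>)) (\<lambda>\<omega>. inf \<sigma> \<tau> \<omega> < \<tau> \<omega>)"
    using hst_min[OF \<sigma> \<tau>] \<tau>
    unfolding horizon_stopping_time_def by (intro filt.stopping_time_less) blast+
  moreover have "(\<lambda>\<omega>. inf \<sigma> \<tau> \<omega> < \<tau> \<omega>) = (\<lambda>\<omega>. \<sigma> \<omega> < \<tau> \<omega>)"
    by (auto simp: inf_min)
  ultimately show ?thesis by (simp add: stopped_def)
qed

lemma pred_eq_Fs_min:
  assumes \<sigma>: "hst \<sigma>" and \<tau>: "hst \<tau>"
  shows "Measurable.pred (Fs (inf \<sigma> \<tau>)) (\<lambda>\<omega>. \<sigma> \<omega> = \<tau> \<omega>)"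
proof -
  have [measurable]: "Measurable.pred (Fs (inf \<sigma> \<tau>)) (\<lambda>\<omega>. \<sigma> \<omega> < \<tau> \<omega>)"
    by (rule pred_less_Fs[OF \<sigma> \<tau>])
  have [measurable]: "Measurable.pred (Fs (inf \<sigma> \<tau>)) (\<lambda>\<omega>. \<tau> \<omega> < \<sigma> \<omega>)"
    using pred_less_Fs[OF \<tau> \<sigma>] by (simp add: inf_commute)
  have "(\<lambda>\<omega>. \<sigma> \<omega> = \<tau> \<omega>) = (\<lambda>\<omega>. \<not> \<sigma> \<omega> < \<tau> \<omega> \<and> \<not> \<tau> \<omega> < \<sigma> \<omega>)" by (auto simp: not_less)
  then show ?thesis by simp
qed

lemma pred_eq_Fs:
  assumes "hst \<sigma>" "hst \<tau>" "hst \<kappa>" "AE \<omega> in M. \<sigma> \<omega> \<le> \<kappa> \<omega> \<or> \<tau> \<omega> \<le> \<kappa> \<omega>"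
  shows "Measurable.pred (Fs \<kappa>) (\<lambda>\<omega>. \<sigma> \<omega> = \<tau> \<omega>)"
  by (rule measurable_Fs_mono[OF pred_eq_Fs_min])
    (use assms in \<open>auto simp: hst_min inf_min min_le_iff_disj\<close>)

text \<open>On \<open>{\<tau> = \<sigma>}\<close> the information available at \<open>\<tau>\<close> and at \<open>\<sigma>\<close> is the same.\<close>

lemma measurable_on_eq:
  fixes f :: "'a \<Rightarrow> real"
  assumes \<sigma>: "hst \<sigma>" and \<tau>: "hst \<tau>" and f: "f \<in> borel_measurable (Fs \<tau>)"
  shows "(\<lambda>\<omega>. if \<tau> \<omega> = \<sigma> \<omega> then f \<omega> else 0) \<in> borel_measurable (Fs \<sigma>)"
proof -
  have E: "{\<omega>\<in>space M. \<tau> \<omega> = \<sigma> \<omega>} \<in> sets (Fs \<sigma>)"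
    using pred_eq_Fs[OF \<tau> \<sigma> \<sigma>] by (auto simp: pred_def)
  have sub: "{\<omega>\<in>A. \<tau> \<omega> = \<sigma> \<omega>} \<in> sets (Fs \<sigma>)" if A: "A \<in> sets (Fs \<tau>)" for A
  proof -
    have "{\<omega>\<in>{\<omega>\<in>A. \<tau> \<omega> = \<sigma> \<omega>}. \<sigma> \<omega> \<le> t} =
        {\<omega>\<in>A. \<tau> \<omega> \<le> t} \<inter> {\<omega>\<in>{\<omega>\<in>space M. \<tau> \<omega> = \<sigma> \<omega>}. \<sigma> \<omega> \<le> t}" for t
      using A by (auto simp: sets_stopped_iff[OF \<tau>])
    moreover have "\<dots> t \<in> sets (F t)" if "t \<in> {0..T}" for t
      using A E that by (auto simp: sets_stopped_iff[OF \<tau>] sets_stopped_iff[OF \<sigma>])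
    ultimately show ?thesis
      using A by (auto simp: sets_stopped_iff[OF \<tau>] sets_stopped_iff[OF \<sigma>])
  qed
  show ?thesis
  proof (rule measurableI)
    fix A :: "real set" assume A: "A \<in> sets borel"
    have "(\<lambda>\<omega>. if \<tau> \<omega> = \<sigma> \<omega> then f \<omega> else 0) -` A \<inter> space (Fs \<sigma>) =
        {\<omega>\<in>f -` A \<inter> space (Fs \<tau>). \<tau> \<omega> = \<sigma> \<omega>} \<union>
        (if 0 \<in> A then space M - {\<omega>\<in>space M. \<tau> \<omega> = \<sigma> \<omega>} else {})"
      by (auto split: if_splits)
    also have "\<dots> \<in> sets (Fs \<sigma>)"
      using sub[OF measurable_sets[OF f A]] sets.compl_sets[OF E] by auto
    finally show "(\<lambda>\<omega>. if \<tau> \<omega> = \<sigma> \<omega> then f \<omega> else 0) -` A \<inter> space (Fs \<sigma>) \<in> sets (Fs \<sigma>)" .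
  qed auto
qed

lemma hst_paste:
  assumes \<sigma>: "hst \<sigma>" and \<tau>: "hst \<tau>"
    and "Measurable.pred (Fs \<sigma>) P" "Measurable.pred (Fs \<tau>) P"
  shows "hst (\<lambda>\<omega>. if P \<omega> then \<sigma> \<omega> else \<tau> \<omega>)"
proof -
  have P: "{\<omega>\<in>space M. P \<omega>} \<in> sets (Fs \<sigma>)" "{\<omega>\<in>space M. \<not> P \<omega>} \<in> sets (Fs \<tau>)"
    using assms(3) assms(4)[THEN pred_intros_logic(2)] by (simp_all add: pred_def)
  have "{\<omega>\<in>space M. (if P \<omega> then \<sigma> \<omega> else \<tau> \<omega>) \<le> t} \<in> sets (F t)" if "t \<in> {0..T}" for t
  proof -
    have "{\<omega>\<in>space M. (if P \<omega> then \<sigma> \<omega> else \<tau> \<omega>) \<le> t} =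
      {\<omega>\<in>{\<omega>\<in>space M. P \<omega>}. \<sigma> \<omega> \<le> t} \<union> {\<omega>\<in>{\<omega>\<in>space M. \<not> P \<omega>}. \<tau> \<omega> \<le> t}" by auto
    also have "\<dots> \<in> sets (F t)"
      using P that by (intro sets.Un) (simp_all only: sets_stopped_iff[OF \<tau>] sets_stopped_iff[OF \<sigma>])
    finally show ?thesis .
  qed
  then show ?thesis
    using hst_range[OF \<sigma>] hst_range[OF \<tau>] by (simp add: horizon_stopping_time_iff)
qed

end

section \<open>Bermudan strategies as a lattice\<close>

context bermudan_setting
begin

abbreviation strats :: "('a \<Rightarrow> real) set" where
  "strats \<equiv> strategies M T F \<theta>"

abbreviation after :: "('a \<Rightarrow> real) \<Rightarrow> ('a \<Rightarrow> real) set" where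
  "after \<equiv> strategies_from M strats"

lemma \<theta>_le: "j \<le> k \<Longrightarrow> AE \<omega> in M. \<theta> j \<omega> \<le> \<theta> k \<omega>"
proof (induction k rule: dec_induct)
  case (step n)
  then show ?case using \<theta>_mono[of n] by (auto elim: AE_mp)
qed auto

lemma hstD: "\<tau> \<in> strats \<Longrightarrow> hst \<tau>"
  by (simp add: strategies_def)

lemma suminf_indicator_disjoint:
  fixes f :: "nat \<Rightarrow> real"
  assumes "disjoint_family A" "\<omega> \<in> A k"
  shows "(\<Sum>k. f k * indicator (A k) \<omega>) = f k"
proof -
  have "f j * indicator (A j) \<omega> = 0" if "j \<noteq> k" for j
    using assms that by (auto simp: disjoint_family_on_def indicator_def)
  then have "(\<Sum>k. f k * indicator (A k) \<omega>) = (\<Sum>j\<in>{k}. f j * indicator (A j) \<omega>)"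
    by (intro suminf_finite) auto
  then show ?thesis using assms(2) by simp
qed

text \<open>The sets \<open>A\<^sub>k\<close> of a strategy can be recovered from its values: let \<open>k\<close> be the first index with
  \<open>\<tau> = \<theta>\<^sub>k\<close>.\<close>

lemma strats_iff:
  "\<tau> \<in> strats \<longleftrightarrow> hst \<tau> \<and> (AE \<omega> in M. \<tau> \<omega> = T \<or> (\<exists>k. \<tau> \<omega> = \<theta> k \<omega>))"
proof (intro iffI conjI)
  assume \<tau>: "\<tau> \<in> strats"
  then show "hst \<tau>" by (rule hstD)
  from \<tau> obtain A Abar where A: "disjoint_family A" "\<And>k. A k \<inter> Abar = {}"
      "(\<Union>k. A k) \<union> Abar = space M"
      "AE \<omega> in M. \<tau> \<omega> = (\<Sum>k. \<theta> k \<omega> * indicator (A k) \<omega>) + T * indicator Abar \<omega>"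
    unfolding strategies_def by blast
  from A(4) AE_space show "AE \<omega> in M. \<tau> \<omega> = T \<or> (\<exists>k. \<tau> \<omega> = \<theta> k \<omega>)"
  proof eventually_elim
    case (elim \<omega>)
    consider k where "\<omega> \<in> A k" | "\<omega> \<in> Abar" "\<And>k. \<omega> \<notin> A k" using elim(2) A(2,3) by blast
    then show ?case
    proof cases
      case 1
      then have "\<omega> \<notin> Abar" using A(2) by blast
      then show ?thesis
        using elim(1) suminf_indicator_disjoint[OF A(1) 1, of "\<lambda>k. \<theta> k \<omega>"] by auto
    next
      case 2
      then show ?thesis using elim(1) by simp
    qed
  qed
next
  assume "hst \<tau> \<and> (AE \<omega> in M. \<tau> \<omega> = T \<or> (\<exists>k. \<tau> \<omega> = \<theta> k \<omega>))"
  then have \<tau>: "hst \<tau>" and val: "AE \<omega> in M. \<tau> \<omega> = T \<or> (\<exists>k. \<tau> \<omega> = \<theta> k \<omega>)" by auto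
  define A where "A k = {\<omega>\<in>space M. \<tau> \<omega> = \<theta> k \<omega> \<and> (\<forall>j<k. \<tau> \<omega> \<noteq> \<theta> j \<omega>)}" for k
  define Abar where "Abar = {\<omega>\<in>space M. \<forall>k. \<tau> \<omega> \<noteq> \<theta> k \<omega>}"
  have A: "A k \<in> sets (Fs (\<theta> k))" for k
  proof -
    have "Measurable.pred (Fs (\<theta> k)) (\<lambda>\<omega>. \<tau> \<omega> = \<theta> j \<omega>)" if "j \<le> k" for j
      using \<theta>_le[OF that] by (intro pred_eq_Fs[OF \<tau> stopping_time_\<theta> stopping_time_\<theta>]) auto
    then have "Measurable.pred (Fs (\<theta> k)) (\<lambda>\<omega>. \<tau> \<omega> = \<theta> k \<omega> \<and> (\<forall>j\<in>{..<k}. \<tau> \<omega> \<noteq> \<theta> j \<omega>))"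
      by (intro pred_intros_logic(2,3) pred_intros_finite(3)) simp_all
    then show ?thesis unfolding A_def pred_def by (simp add: Ball_def)
  qed
  have hT: "hst (\<lambda>_. T)" using horizon_pos by (intro hst_const) auto
  have FT: "sets (Fs (\<lambda>_. T)) \<subseteq> sets (F T)"
  proof
    fix X assume "X \<in> sets (Fs (\<lambda>_. T))"
    then have "\<forall>t\<in>{0..T}. {\<omega>\<in>X. T \<le> t} \<in> sets (F t)" unfolding sets_stopped_iff[OF hT] by blast
    from this[rule_format, of T] show "X \<in> sets (F T)" using horizon_pos by simp
  qed
  have "Measurable.pred (Fs (\<lambda>_. T)) (\<lambda>\<omega>. \<tau> \<omega> = \<theta> j \<omega>)" for j
    using hst_range[OF \<tau>] by (intro pred_eq_Fs[OF \<tau> stopping_time_\<theta> hT]) auto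
  then have "Measurable.pred (Fs (\<lambda>_. T)) (\<lambda>\<omega>. \<forall>k. \<tau> \<omega> \<noteq> \<theta> k \<omega>)"
    by (intro pred_intros_countable(1) pred_intros_logic(2))
  then have "Abar \<in> sets (F T)" using FT by (auto simp: Abar_def pred_def)
  moreover have disj: "disjoint_family A"
    unfolding disjoint_family_on_def A_def by auto (metis linorder_neqE_nat)
  moreover have "A k \<inter> Abar = {}" for k by (auto simp: A_def Abar_def)
  moreover have "(\<Union>k. A k) \<union> Abar = space M"
  proof -
    have "\<exists>k. \<omega> \<in> A k" if "\<omega> \<in> space M" "\<omega> \<notin> Abar" for \<omega>
    proof -
      have ex: "\<exists>k. \<tau> \<omega> = \<theta> k \<omega>" using that by (auto simp: Abar_def)
      have "\<omega> \<in> A (LEAST k. \<tau> \<omega> = \<theta> k \<omega>)"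
        unfolding A_def using LeastI_ex[OF ex] not_less_Least that(1) by auto
      then show ?thesis ..
    qed
    then show ?thesis by (auto simp: A_def Abar_def)
  qed
  moreover have "AE \<omega> in M. \<tau> \<omega> = (\<Sum>k. \<theta> k \<omega> * indicator (A k) \<omega>) + T * indicator Abar \<omega>"
    using val AE_space
  proof eventually_elim
    case (elim \<omega>)
    consider k where "\<omega> \<in> A k" "\<omega> \<notin> Abar" | "\<omega> \<in> Abar" "\<And>k. \<omega> \<notin> A k"
      using \<open>(\<Union>k. A k) \<union> Abar = space M\<close> \<open>\<And>k. A k \<inter> Abar = {}\<close> elim(2) by blast
    then show ?case
    proof cases
      case 1
      then show ?thesis
        using suminf_indicator_disjoint[OF disj 1(1), of "\<lambda>k. \<theta> k \<omega>"] by (auto simp: A_def)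
    next
      case 2
      then show ?thesis using elim by (auto simp: Abar_def)
    qed
  qed
  ultimately show "\<tau> \<in> strats" unfolding strategies_def using A \<tau> by blast
qed

text \<open>The values of a strategy are its only constraint besides being a stopping time, so a stopping
  time that selects its value among finitely many strategies is a strategy. Minima, maxima, pasted
  times and order statistics are of this kind.\<close>

lemma stratsI:
  assumes "hst \<kappa>" "set \<tau>s \<subseteq> strats" "AE \<omega> in M. \<exists>\<tau>\<in>set \<tau>s. \<kappa> \<omega> = \<tau> \<omega>"
  shows "\<kappa> \<in> strats"
proof -
  have "AE \<omega> in M. \<forall>\<tau>\<in>set \<tau>s. \<tau> \<omega> = T \<or> (\<exists>k. \<tau> \<omega> = \<theta> k \<omega>)"
    using assms(2) strats_iff by (intro AE_finite_allI) blast+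
  then have "AE \<omega> in M. \<kappa> \<omega> = T \<or> (\<exists>k. \<kappa> \<omega> = \<theta> k \<omega>)"
    using assms(3) by eventually_elim fastforce
  then show ?thesis using assms(1) strats_iff by blast
qed

lemma strats_inf: "\<sigma> \<in> strats \<Longrightarrow> \<tau> \<in> strats \<Longrightarrow> inf \<sigma> \<tau> \<in> strats"
  by (rule stratsI[of _ "[\<sigma>, \<tau>]"]) (simp_all add: hst_min hstD inf_real_def min_def)

lemma strats_sup: "\<sigma> \<in> strats \<Longrightarrow> \<tau> \<in> strats \<Longrightarrow> sup \<sigma> \<tau> \<in> strats"
  by (rule stratsI[of _ "[\<sigma>, \<tau>]"]) (simp_all add: hst_max hstD sup_real_def max_def)

lemma strats_T: "(\<lambda>_. T) \<in> strats"
  using horizon_pos by (auto simp: strats_iff hst_const)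

lemma strats_paste:
  assumes "\<sigma> \<in> strats" "\<tau> \<in> strats" "Measurable.pred (Fs \<sigma>) P" "Measurable.pred (Fs \<tau>) P"
  shows "(\<lambda>\<omega>. if P \<omega> then \<sigma> \<omega> else \<tau> \<omega>) \<in> strats"
  by (rule stratsI[of _ "[\<sigma>, \<tau>]"]) (use assms in \<open>simp_all add: hst_paste hstD\<close>)

lemma afterD: "\<tau> \<in> after S \<Longrightarrow> \<tau> \<in> strats" "\<tau> \<in> after S \<Longrightarrow> AE \<omega> in M. S \<omega> \<le> \<tau> \<omega>"
  by (auto simp: strategies_from_def)

lemma afterI: "\<tau> \<in> strats \<Longrightarrow> AE \<omega> in M. S \<omega> \<le> \<tau> \<omega> \<Longrightarrow> \<tau> \<in> after S"
  by (auto simp: strategies_from_def)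

lemma after_refl: "S \<in> strats \<Longrightarrow> S \<in> after S"
  by (auto intro: afterI)

lemma after_trans:
  assumes "\<sigma> \<in> after S" "\<tau> \<in> after \<sigma>" shows "\<tau> \<in> after S"
proof (rule afterI)
  show "AE \<omega> in M. S \<omega> \<le> \<tau> \<omega>"
    using afterD(2)[OF assms(1)] afterD(2)[OF assms(2)] by eventually_elim simp
qed (rule afterD(1)[OF assms(2)])

end

section \<open>Order statistics of a tuple of strategies\<close>

lemma sort_nth_le_iff:
  fixes xs :: "'b :: linorder list"
  assumes "i < length xs"
  shows "sort xs ! i \<le> t \<longleftrightarrow> i < length (filter (\<lambda>x. x \<le> t) xs)"
proof -
  have *: "ys ! i \<le> t \<longleftrightarrow> i < length (filter (\<lambda>x. x \<le> t) ys)"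
    if "sorted ys" "i < length ys" for ys :: "'b list" and i
    using that
  proof (induction ys arbitrary: i)
    case (Cons y ys)
    show ?case
    proof (cases "y \<le> t")
      case True
      then show ?thesis using Cons by (cases i) auto
    next
      case False
      then have "filter (\<lambda>x. x \<le> t) (y # ys) = []" using Cons.prems(1) by (auto simp: filter_empty_conv)
      moreover have "y \<le> (y # ys) ! i" using Cons.prems by (cases i) auto
      ultimately show ?thesis using False by auto
    qed
  qed auto
  have "mset (filter (\<lambda>x. x \<le> t) (sort xs)) = mset (filter (\<lambda>x. x \<le> t) xs)" by simp
  then have "length (filter (\<lambda>x. x \<le> t) (sort xs)) = length (filter (\<lambda>x. x \<le> t) xs)"
    by (rule mset_eq_length)
  then show ?thesis using *[of "sort xs" i] assms by simp
qed

text \<open>Defined pointwise everywhere, not only almost surely, so that the latest of the times is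
  unchanged as a function (\<open>latest_order_stats\<close>).\<close>

definition order_stats :: "('a \<Rightarrow> 'b :: linorder) list \<Rightarrow> ('a \<Rightarrow> 'b) list" where
  "order_stats \<tau>s = map (\<lambda>i \<omega>. sort (map (\<lambda>\<tau>. \<tau> \<omega>) \<tau>s) ! i) [0..<length \<tau>s]"

lemma length_order_stats [simp]: "length (order_stats \<tau>s) = length \<tau>s"
  by (simp add: order_stats_def)

lemma order_stats_nth:
  "i < length \<tau>s \<Longrightarrow> (order_stats \<tau>s ! i) \<omega> = sort (map (\<lambda>\<tau>. \<tau> \<omega>) \<tau>s) ! i"
  by (simp add: order_stats_def)

lemma order_stats_values:
  "(\<lambda>\<tau>. \<tau> \<omega>) ` set (order_stats \<tau>s) = (\<lambda>\<tau>. \<tau> \<omega>) ` set \<tau>s"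
proof -
  have "(\<lambda>\<tau>. \<tau> \<omega>) ` set (order_stats \<tau>s) = set (map (\<lambda>i. sort (map (\<lambda>\<tau>. \<tau> \<omega>) \<tau>s) ! i) [0..<length \<tau>s])"
    by (auto simp: order_stats_def)
  also have "\<dots> = set (sort (map (\<lambda>\<tau>. \<tau> \<omega>) \<tau>s))"
    using map_nth[of "sort (map (\<lambda>\<tau>. \<tau> \<omega>) \<tau>s)"] by simp
  finally show ?thesis by simp
qed

lemma latest_order_stats: "latest (order_stats \<tau>s) = latest \<tau>s"
  by (simp add: latest_def order_stats_values fun_eq_iff)

lemma (in horizon_filtration) hst_order_stats:
  assumes \<tau>s: "\<And>\<tau>. \<tau> \<in> set \<tau>s \<Longrightarrow> hst \<tau>" and i: "i < length \<tau>s"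
  shows "hst (order_stats \<tau>s ! i)"
  unfolding horizon_stopping_time_iff
proof (intro conjI ballI)
  fix t assume t: "t \<in> {0..T}"
  have sp: "space (F t) = space M" using subalgebra_F[OF t] by (simp add: subalgebra_def)
  \<comment> \<open>the event says that more than \<open>i\<close> of the times have occurred by \<open>t\<close>\<close>
  let ?J = "{J. J \<subseteq> {..<length \<tau>s} \<and> i < card J}"
  have "{\<omega>\<in>space M. (order_stats \<tau>s ! i) \<omega> \<le> t} = 
      {\<omega>\<in>space M. \<exists>J\<in>?J. \<forall>j\<in>J. (\<tau>s ! j) \<omega> \<le> t}"
  proof -
    have "(order_stats \<tau>s ! i) \<omega> \<le> t \<longleftrightarrow> (\<exists>J\<in>?J. \<forall>j\<in>J. (\<tau>s ! j) \<omega> \<le> t)" for \<omega>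
    proof -
      define K where "K = {j. j < length \<tau>s \<and> (\<tau>s ! j) \<omega> \<le> t}"
      have fK: "finite K" by (simp add: K_def)
      have "length (filter (\<lambda>x. x \<le> t) (map (\<lambda>\<tau>. \<tau> \<omega>) \<tau>s)) = card K"
        by (auto simp: length_filter_conv_card K_def intro: arg_cong[where f = card])
      then have 1: "(order_stats \<tau>s ! i) \<omega> \<le> t \<longleftrightarrow> i < card K"
        using sort_nth_le_iff[of i "map (\<lambda>\<tau>. \<tau> \<omega>) \<tau>s" t] i by (simp add: order_stats_nth)
      have "K \<in> ?J" if "i < card K" using that by (auto simp: K_def)
      moreover have "i < card K" if J: "J \<in> ?J" "\<forall>j\<in>J. (\<tau>s ! j) \<omega> \<le> t" for J
      proof -
        have "J \<subseteq> K" using J by (auto simp: K_def)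
        then show ?thesis using card_mono[OF fK, of J] J(1) by simp
      qed
      ultimately show ?thesis unfolding 1 by (auto simp: K_def)
    qed
    then show ?thesis by simp
  qed
  also have "\<dots> \<in> sets (F t)"
    unfolding sp[symmetric]
  proof (intro sets.sets_Collect_finite_Ex sets.sets_Collect_finite_All)
    fix J j assume "J \<in> ?J" "j \<in> J"
    then have "hst (\<tau>s ! j)" by (auto intro!: \<tau>s)
    then show "{\<omega>\<in>space (F t). (\<tau>s ! j) \<omega> \<le> t} \<in> sets (F t)" using hst_le t sp by simp
  qed (auto intro: finite_subset)
  finally show "{\<omega>\<in>space M. (order_stats \<tau>s ! i) \<omega> \<le> t} \<in> sets (F t)" .
next
  fix \<omega> assume \<omega>: "\<omega> \<in> space M"
  have "(order_stats \<tau>s ! i) \<omega> \<in> (\<lambda>\<tau>. \<tau> \<omega>) ` set \<tau>s"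
    using imageI[OF nth_mem[of i "order_stats \<tau>s"], of "\<lambda>\<tau>. \<tau> \<omega>"] i by (simp add: order_stats_values)
  then show "(order_stats \<tau>s ! i) \<omega> \<in> {0..T}" using hst_range[OF \<tau>s] \<omega> by auto
qed

lemma (in bermudan_setting) order_stats_ordered:
  assumes \<tau>s: "\<tau>s \<in> tuples d (after S)"
  shows "order_stats \<tau>s \<in> ordered_tuples M d (after S)"
proof -
  have len: "length \<tau>s = d" and sub: "set \<tau>s \<subseteq> after S" using \<tau>s by (auto simp: tuples_def)
  have val: "\<exists>\<tau>\<in>set \<tau>s. (order_stats \<tau>s ! i) \<omega> = \<tau> \<omega>" if "i < d" for i \<omega>
  proof -
    have "(order_stats \<tau>s ! i) \<omega> \<in> (\<lambda>\<tau>. \<tau> \<omega>) ` set \<tau>s"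
      using imageI[OF nth_mem[of i "order_stats \<tau>s"], of "\<lambda>\<tau>. \<tau> \<omega>"] that len
      by (simp add: order_stats_values)
    then show ?thesis by auto
  qed
  have "order_stats \<tau>s ! i \<in> after S" if i: "i < d" for i
  proof (rule afterI)
    show "order_stats \<tau>s ! i \<in> strats"
    proof (rule stratsI)
      show "set \<tau>s \<subseteq> strats" using sub afterD(1) by blast
      then show "hst (order_stats \<tau>s ! i)" using i len hstD by (intro hst_order_stats) blast+
      show "AE \<omega> in M. \<exists>\<tau>\<in>set \<tau>s. (order_stats \<tau>s ! i) \<omega> = \<tau> \<omega>" using val[OF i] by simp
    qed
    have "AE \<omega> in M. \<forall>\<tau>\<in>set \<tau>s. S \<omega> \<le> \<tau> \<omega>"
      using sub afterD(2) by (intro AE_finite_allI) blast+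
    then show "AE \<omega> in M. S \<omega> \<le> (order_stats \<tau>s ! i) \<omega>"
    proof eventually_elim
      case (elim \<omega>)
      then show ?case using val[OF i, of \<omega>] by fastforce
    qed
  qed
  moreover have "sorted_wrt (\<lambda>\<sigma> \<tau>. AE \<omega> in M. \<sigma> \<omega> \<le> \<tau> \<omega>) (order_stats \<tau>s)"
    unfolding sorted_wrt_iff_nth_less
  proof (intro allI impI AE_I2)
    fix i j \<omega> assume "i < j" "j < length (order_stats \<tau>s)"
    then show "(order_stats \<tau>s ! i) \<omega> \<le> (order_stats \<tau>s ! j) \<omega>"
      by (simp add: order_stats_nth sorted_nth_mono)
  qed
  ultimately show ?thesis
    using len by (auto simp: ordered_tuples_def tuples_def in_set_conv_nth)
qed

text \<open>The sorting permutation depends on \<open>\<omega>\<close>, but there are only finitely many permutations. On the event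
  where \<open>\<pi>\<close> sorts, symmetry moves the reward to the tuple permuted by \<open>\<pi>\<close>, and admissibility moves it on
  to the order statistics.\<close>

lemma (in bermudan_setting) symmetric_order_stats:
  assumes sym: "symmetric_family M strats d \<psi>" and adm: "multi_admissible M T F \<theta> d \<psi>"
    and \<tau>s: "\<tau>s \<in> tuples d strats" and os: "order_stats \<tau>s \<in> tuples d strats"
  shows "AE \<omega> in M. \<psi> \<tau>s \<omega> = \<psi> (order_stats \<tau>s) \<omega>"
proof -
  have len: "length \<tau>s = d" using \<tau>s by (simp add: tuples_def)
  let ?P = "{\<pi>. \<pi> permutes {..<d}}"
  have fin: "finite ?P" by (rule finite_permutations) simp
  have perm: "permute_list \<pi> \<tau>s \<in> tuples d strats" if "\<pi> \<in> ?P" for \<pi>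
    using that \<tau>s len by (auto simp: tuples_def)
  have 1: "AE \<omega> in M. \<forall>\<pi>\<in>?P. \<psi> \<tau>s \<omega> = \<psi> (permute_list \<pi> \<tau>s) \<omega>"
    using sym \<tau>s by (intro AE_finite_allI[OF fin]) (auto simp: symmetric_family_def)
  have 2: "AE \<omega> in M. \<forall>\<pi>\<in>?P. (\<forall>i<d. (permute_list \<pi> \<tau>s ! i) \<omega> = (order_stats \<tau>s ! i) \<omega>) \<longrightarrow>
      \<psi> (permute_list \<pi> \<tau>s) \<omega> = \<psi> (order_stats \<tau>s) \<omega>"
    using adm perm os by (intro AE_finite_allI[OF fin]) (auto simp: multi_admissible_def)
  from 1 2 show ?thesis
  proof eventually_elim
    case (elim \<omega>)
    let ?x = "map (\<lambda>\<tau>. \<tau> \<omega>) \<tau>s"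
    have "mset (sort ?x) = mset ?x" by simp
    then obtain \<pi> where \<pi>: "\<pi> permutes {..<length ?x}" "permute_list \<pi> ?x = sort ?x"
      by (rule mset_eq_permutation)
    have "(permute_list \<pi> \<tau>s ! i) \<omega> = (order_stats \<tau>s ! i) \<omega>" if i: "i < d" for i
    proof -
      have "\<pi> i < d" using permutes_in_image[OF \<pi>(1), of i] i len by simp
      then have "(permute_list \<pi> \<tau>s ! i) \<omega> = permute_list \<pi> ?x ! i"
        using i len \<pi>(1) by (simp add: permute_list_nth)
      then show ?thesis using \<pi>(2) i len by (simp add: order_stats_nth)
    qed
    then show ?case using elim \<pi>(1) len by auto
  qed
qed

section \<open>Integrability\<close>

context horizon_filtration
begin

text \<open>Domination by a maximum, instead of a sum, fits truncated and pasted random variables and treats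
  \<open>p < \<infinity>\<close> and \<open>p = \<infinity>\<close> alike.\<close>

lemma Lp_dominated:
  assumes f: "f \<in> borel_measurable M" and g: "g \<in> Lp M p M" and h: "h \<in> Lp M p M"
    and le: "AE \<omega> in M. \<bar>f \<omega>\<bar> \<le> max \<bar>g \<omega>\<bar> \<bar>h \<omega>\<bar>"
  shows "f \<in> Lp M p M"
proof (cases "p = \<infinity>")
  case True
  have [measurable]: "f \<in> borel_measurable M" "g \<in> borel_measurable M" "h \<in> borel_measurable M"
    using f g h by (auto simp: Lp_def)
  have fin: "esssup M (\<lambda>\<omega>. ereal \<bar>g \<omega>\<bar>) < \<infinity>" "esssup M (\<lambda>\<omega>. ereal \<bar>h \<omega>\<bar>) < \<infinity>"
    using g h True by (auto simp: Lp_def)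
  have "AE \<omega> in M. ereal \<bar>g \<omega>\<bar> \<le> esssup M (\<lambda>\<omega>. ereal \<bar>g \<omega>\<bar>)"
       "AE \<omega> in M. ereal \<bar>h \<omega>\<bar> \<le> esssup M (\<lambda>\<omega>. ereal \<bar>h \<omega>\<bar>)"
    by (intro esssup_AE; measurable)+
  with le have "AE \<omega> in M. ereal \<bar>f \<omega>\<bar> \<le> max (esssup M (\<lambda>\<omega>. ereal \<bar>g \<omega>\<bar>)) (esssup M (\<lambda>\<omega>. ereal \<bar>h \<omega>\<bar>))"
  proof eventually_elim
    case (elim \<omega>)
    then have "ereal \<bar>f \<omega>\<bar> \<le> max (ereal \<bar>g \<omega>\<bar>) (ereal \<bar>h \<omega>\<bar>)" by (simp add: max_def split: if_splits)
    also have "\<dots> \<le> max (esssup M (\<lambda>\<omega>. ereal \<bar>g \<omega>\<bar>)) (esssup M (\<lambda>\<omega>. ereal \<bar>h \<omega>\<bar>))"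
      using elim by (intro max.mono)
    finally show ?case .
  qed
  then have "esssup M (\<lambda>\<omega>. ereal \<bar>f \<omega>\<bar>) \<le> max (esssup M (\<lambda>\<omega>. ereal \<bar>g \<omega>\<bar>)) (esssup M (\<lambda>\<omega>. ereal \<bar>h \<omega>\<bar>))"
    by (intro esssup_I) measurable
  also have "\<dots> < \<infinity>" using fin by (simp add: max_def)
  finally show ?thesis using True f by (simp add: Lp_def)
next
  case False
  let ?q = "enn2real p"
  have [measurable]: "f \<in> borel_measurable M" by (rule f)
  have "integrable M (\<lambda>\<omega>. \<bar>g \<omega>\<bar> powr ?q + \<bar>h \<omega>\<bar> powr ?q)"
    using g h False by (intro Bochner_Integration.integrable_add) (auto simp: Lp_def)
  moreover have "AE \<omega> in M. norm (\<bar>f \<omega>\<bar> powr ?q) \<le> norm (\<bar>g \<omega>\<bar> powr ?q + \<bar>h \<omega>\<bar> powr ?q)"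
    using le
  proof eventually_elim
    case (elim \<omega>)
    have "\<bar>f \<omega>\<bar> powr ?q \<le> max \<bar>g \<omega>\<bar> \<bar>h \<omega>\<bar> powr ?q"
      using elim by (intro powr_mono2) auto
    also have "\<dots> \<le> \<bar>g \<omega>\<bar> powr ?q + \<bar>h \<omega>\<bar> powr ?q" by (simp add: max_def)
    finally show ?case by simp
  qed
  moreover have "(\<lambda>\<omega>. \<bar>f \<omega>\<bar> powr ?q) \<in> borel_measurable M" by measurable
  ultimately have "integrable M (\<lambda>\<omega>. \<bar>f \<omega>\<bar> powr ?q)"
    by (blast intro: Bochner_Integration.integrable_bound)
  then show ?thesis using False f by (simp add: Lp_def)
qed

lemma Lp_Fs_iff:
  assumes "hst \<tau>"
  shows "f \<in> Lp M p (Fs \<tau>) \<longleftrightarrow> f \<in> borel_measurable (Fs \<tau>) \<and> f \<in> Lp M p M"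
proof -
  have "f \<in> borel_measurable (Fs \<tau>) \<Longrightarrow> f \<in> borel_measurable M" by (rule Fs_into_M[OF assms])
  then show ?thesis unfolding Lp_def mem_Collect_eq by argo
qed

lemma Lp_mono:
  assumes "f \<in> Lp M p (Fs \<sigma>)" "hst \<sigma>" "hst \<tau>" "AE \<omega> in M. \<sigma> \<omega> \<le> \<tau> \<omega>"
  shows "f \<in> Lp M p (Fs \<tau>)"
proof -
  have f: "f \<in> borel_measurable (Fs \<sigma>)" "f \<in> Lp M p M"
    using assms(1) unfolding Lp_Fs_iff[OF assms(2)] by blast+
  from measurable_Fs_mono[OF f(1) assms(2-4)] f(2) show ?thesis
    unfolding Lp_Fs_iff[OF assms(3)] by (rule conjI)
qed

lemma Lp_AE:
  assumes f: "f \<in> Lp M p (Fs \<tau>)" and \<tau>: "hst \<tau>" and eq: "AE \<omega> in M. f \<omega> = g \<omega>"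
  shows "g \<in> Lp M p (Fs \<tau>)"
proof -
  have g: "g \<in> borel_measurable (Fs \<tau>)"
    by (rule measurable_Fs_AE[OF \<tau> _ eq]) (use f in \<open>simp add: Lp_def\<close>)
  moreover have "g \<in> Lp M p M"
    by (rule Lp_dominated[of _ f _ f]) (use f eq Fs_into_M[OF \<tau> g] \<tau> in \<open>auto simp: Lp_Fs_iff\<close>)
  ultimately show ?thesis by (simp add: Lp_Fs_iff \<tau>)
qed

lemma Lp_if:
  assumes "f \<in> Lp M p (Fs \<tau>)" "g \<in> Lp M p (Fs \<tau>)" "hst \<tau>" "Measurable.pred (Fs \<tau>) P"
  shows "(\<lambda>\<omega>. if P \<omega> then f \<omega> else g \<omega>) \<in> Lp M p (Fs \<tau>)"
proof -
  have m: "(\<lambda>\<omega>. if P \<omega> then f \<omega> else g \<omega>) \<in> borel_measurable (Fs \<tau>)"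
    using assms by (intro measurable_If) (auto simp: Lp_def pred_def)
  moreover have "(\<lambda>\<omega>. if P \<omega> then f \<omega> else g \<omega>) \<in> Lp M p M"
    by (rule Lp_dominated[of _ f _ g]) (use assms Fs_into_M[OF _ m] in \<open>auto simp: Lp_Fs_iff\<close>)
  ultimately show ?thesis by (simp add: Lp_Fs_iff assms(3))
qed

lemma Lp_indicator:
  assumes "f \<in> Lp M p (Fs \<tau>)" "hst \<tau>" "Measurable.pred (Fs \<tau>) P"
  shows "(\<lambda>\<omega>. if P \<omega> then f \<omega> else 0) \<in> Lp M p (Fs \<tau>)"
proof -
  have m: "(\<lambda>\<omega>. if P \<omega> then f \<omega> else 0) \<in> borel_measurable (Fs \<tau>)"
    using assms by (intro measurable_If) (auto simp: Lp_def pred_def)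
  moreover have "(\<lambda>\<omega>. if P \<omega> then f \<omega> else 0) \<in> Lp M p M"
    by (rule Lp_dominated[of _ f _ f]) (use assms Fs_into_M[OF _ m] in \<open>auto simp: Lp_Fs_iff\<close>)
  ultimately show ?thesis by (simp add: Lp_Fs_iff assms(2))
qed

lemma Lp_on_eq:
  assumes \<sigma>: "hst \<sigma>" and \<tau>: "hst \<tau>" and f: "f \<in> Lp M p (Fs \<tau>)"
  shows "(\<lambda>\<omega>. if \<tau> \<omega> = \<sigma> \<omega> then f \<omega> else 0) \<in> Lp M p (Fs \<sigma>)"
proof -
  have m: "(\<lambda>\<omega>. if \<tau> \<omega> = \<sigma> \<omega> then f \<omega> else 0) \<in> borel_measurable (Fs \<sigma>)"
    using f by (intro measurable_on_eq[OF \<sigma> \<tau>]) (auto simp: Lp_def)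
  moreover have "(\<lambda>\<omega>. if \<tau> \<omega> = \<sigma> \<omega> then f \<omega> else 0) \<in> Lp M p M"
    by (rule Lp_dominated[of _ f _ f]) (use f Fs_into_M[OF \<sigma> m] \<tau> in \<open>auto simp: Lp_Fs_iff\<close>)
  ultimately show ?thesis by (simp add: Lp_Fs_iff \<sigma>)
qed

end

section \<open>Essential suprema of directed families\<close>

text \<open>The representative chosen by \<open>ess_SUP\<close> is only known to be measurable at the end of time, but it is
  almost surely equal to a countable supremum, and null sets are known at time \<open>0\<close>.\<close>

lemma (in horizon_filtration) ess_SUP_measurable_Fs:
  assumes \<tau>: "hst \<tau>" and X: "\<And>i. i \<in> I \<Longrightarrow> X i \<in> borel_measurable (Fs \<tau>)"
  shows "ess_SUP M I X \<in> borel_measurable (Fs \<tau>)"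
proof -
  have XM: "X i \<in> borel_measurable M" if "i \<in> I" for i using Fs_into_M[OF \<tau> X[OF that]] .
  obtain J where J: "countable J" "J \<subseteq> I" "is_ess_SUP M I X (\<lambda>\<omega>. SUP i\<in>J. ereal (X i \<omega>))"
    by (rule ess_SUP_countable[of I X]) (use XM in auto)
  show ?thesis
  proof (rule measurable_Fs_AE[OF \<tau>])
    show "(\<lambda>\<omega>. SUP i\<in>J. ereal (X i \<omega>)) \<in> borel_measurable (Fs \<tau>)"
      using J X by (intro borel_measurable_SUP) auto
    show "AE \<omega> in M. (SUP i\<in>J. ereal (X i \<omega>)) = ess_SUP M I X \<omega>"
      using is_ess_SUP_unique[OF J(3) is_ess_SUP_ess_SUP] XM by blast
  qed
qed

text \<open>A countable subfamily attains the essential supremum, and directedness lets \<open>t (Suc n)\<close> dominate both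
  \<open>t n\<close> and the \<open>n\<close>-th member of this subfamily.\<close>

lemma (in prob_space) directed_ess_SUP_sequence:
  fixes X :: "'b \<Rightarrow> 'a \<Rightarrow> real"
  assumes ne: "I \<noteq> {}" and X: "\<And>i. i \<in> I \<Longrightarrow> X i \<in> borel_measurable M"
    and dir: "\<And>a b. a \<in> I \<Longrightarrow> b \<in> I \<Longrightarrow> \<exists>c\<in>I. AE \<omega> in M. max (X a \<omega>) (X b \<omega>) \<le> X c \<omega>"
  obtains t :: "nat \<Rightarrow> 'b" where "\<And>n. t n \<in> I" "\<And>n. AE \<omega> in M. X (t n) \<omega> \<le> X (t (Suc n)) \<omega>"
    "AE \<omega> in M. (\<lambda>n. ereal (X (t n) \<omega>)) \<longlonglongrightarrow> ess_SUP M I X \<omega>"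
proof -
  obtain J where J: "countable J" "J \<subseteq> I" "is_ess_SUP M I X (\<lambda>\<omega>. SUP i\<in>J. ereal (X i \<omega>))"
    by (rule ess_SUP_countable[of I X]) (use X in auto)
  note ess = is_ess_SUP_ess_SUP[of I X, OF X]
  obtain i0 where i0: "i0 \<in> I" using ne by blast
  define j where "j = from_nat_into (insert i0 J)"
  have range_j: "range j = insert i0 J" unfolding j_def using J(1) by (intro range_from_nat_into) auto
  then have jI: "j n \<in> I" for n using i0 J(2) by auto
  obtain c where c: "\<And>a b. a \<in> I \<Longrightarrow> b \<in> I \<Longrightarrow> c a b \<in> I"
    "\<And>a b. a \<in> I \<Longrightarrow> b \<in> I \<Longrightarrow> AE \<omega> in M. max (X a \<omega>) (X b \<omega>) \<le> X (c a b) \<omega>"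
    using dir by metis
  define t where "t = rec_nat i0 (\<lambda>n a. c a (j n))"
  have t_Suc: "t (Suc n) = c (t n) (j n)" for n by (simp add: t_def)
  have tI: "t n \<in> I" for n
    by (induction n) (auto simp: t_Suc c(1) jI, simp add: t_def i0)
  have step: "AE \<omega> in M. max (X (t n) \<omega>) (X (j n) \<omega>) \<le> X (t (Suc n)) \<omega>" for n
    unfolding t_Suc by (rule c(2)[OF tI jI])
  have "AE \<omega> in M. \<forall>n. max (X (t n) \<omega>) (X (j n) \<omega>) \<le> X (t (Suc n)) \<omega>"
    using step by (simp add: AE_all_countable)
  moreover have "AE \<omega> in M. \<forall>n. ereal (X (t n) \<omega>) \<le> ess_SUP M I X \<omega>"
    using ess tI by (simp add: AE_all_countable is_ess_SUP_def)
  moreover have "AE \<omega> in M. (SUP i\<in>J. ereal (X i \<omega>)) = ess_SUP M I X \<omega>"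
    by (rule is_ess_SUP_unique[OF J(3) ess])
  ultimately have lim: "AE \<omega> in M. (\<lambda>n. ereal (X (t n) \<omega>)) \<longlonglongrightarrow> ess_SUP M I X \<omega>"
  proof eventually_elim
    case (elim \<omega>)
    have "incseq (\<lambda>n. ereal (X (t n) \<omega>))" using elim(1) by (intro incseq_SucI) auto
    then have "(\<lambda>n. ereal (X (t n) \<omega>)) \<longlonglongrightarrow> (SUP n. ereal (X (t n) \<omega>))" by (rule LIMSEQ_SUP)
    moreover have "(SUP n. ereal (X (t n) \<omega>)) = ess_SUP M I X \<omega>"
    proof (rule antisym)
      show "(SUP n. ereal (X (t n) \<omega>)) \<le> ess_SUP M I X \<omega>" using elim(2) by (auto intro: SUP_least)
      have "(SUP i\<in>J. ereal (X i \<omega>)) \<le> (SUP n. ereal (X (t n) \<omega>))"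
      proof (rule SUP_least)
        fix i assume "i \<in> J"
        then obtain n where "i = j n" using range_j by (metis insertI2 rangeE)
        then have "ereal (X i \<omega>) \<le> ereal (X (t (Suc n)) \<omega>)" using elim(1) by auto
        also have "\<dots> \<le> (SUP n. ereal (X (t n) \<omega>))" by (rule SUP_upper) simp
        finally show "ereal (X i \<omega>) \<le> (SUP n. ereal (X (t n) \<omega>))" .
      qed
      then show "ess_SUP M I X \<omega> \<le> (SUP n. ereal (X (t n) \<omega>))" using elim(3) by simp
    qed
    ultimately show ?case by simp
  qed
  show thesis
  proof (rule that[OF tI _ lim])
    show "AE \<omega> in M. X (t n) \<omega> \<le> X (t (Suc n)) \<omega>" for n using step[of n] by eventually_elim simp
  qed
qed

section \<open>Ordered tuples of strategies\<close>

context bermudan_setting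
begin

lemma ordered_last:
  assumes "Q \<in> ordered_tuples M i (after S)" "1 \<le> i"
  shows "last Q \<in> after S" "last Q \<in> strats" "\<And>\<tau>. \<tau> \<in> set Q \<Longrightarrow> AE \<omega> in M. \<tau> \<omega> \<le> last Q \<omega>"
proof -
  have ne: "Q \<noteq> []" and sub: "set Q \<subseteq> after S"
    and ord: "sorted_wrt (\<lambda>\<sigma> \<tau>. AE \<omega> in M. \<sigma> \<omega> \<le> \<tau> \<omega>) Q"
    using assms by (auto simp: ordered_tuples_def tuples_def)
  show "last Q \<in> after S" using ne sub by (meson last_in_set subsetD)
  then show "last Q \<in> strats" by (rule afterD)
  fix \<tau> assume \<tau>: "\<tau> \<in> set Q"
  have "sorted_wrt (\<lambda>\<sigma> \<tau>. AE \<omega> in M. \<sigma> \<omega> \<le> \<tau> \<omega>) (butlast Q @ [last Q])" using ord ne by simp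
  then have "\<forall>\<sigma>\<in>set (butlast Q). AE \<omega> in M. \<sigma> \<omega> \<le> last Q \<omega>" by (simp add: sorted_wrt_append)
  moreover have "\<tau> \<in> set (butlast Q @ [last Q])" using \<tau> ne by simp
  ultimately show "AE \<omega> in M. \<tau> \<omega> \<le> last Q \<omega>" by auto
qed

lemma ordered_append:
  assumes Q: "Q \<in> ordered_tuples M i (after S)" and i: "1 \<le> i" and \<tau>: "\<tau> \<in> after (last Q)"
  shows "Q @ [\<tau>] \<in> ordered_tuples M (Suc i) (after S)"
proof -
  have "AE \<omega> in M. \<sigma> \<omega> \<le> \<tau> \<omega>" if "\<sigma> \<in> set Q" for \<sigma>
    using ordered_last(3)[OF Q i that] afterD(2)[OF \<tau>] by eventually_elim simp
  moreover have "\<tau> \<in> after S" by (rule after_trans[OF ordered_last(1)[OF Q i] \<tau>])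
  ultimately show ?thesis using Q by (simp add: ordered_tuples_def tuples_def sorted_wrt_append)
qed

lemma ordered_appendD:
  assumes Q: "Q @ [\<tau>] \<in> ordered_tuples M (Suc i) (after S)"
  shows "Q \<in> ordered_tuples M i (after S)" "\<tau> \<in> after S" "Q \<noteq> [] \<Longrightarrow> \<tau> \<in> after (last Q)"
  using Q afterD(1)[of \<tau> S]
  by (auto simp: ordered_tuples_def tuples_def sorted_wrt_append intro: afterI)

lemma ordered_singleton: "\<tau> \<in> after S \<Longrightarrow> [\<tau>] \<in> ordered_tuples M 1 (after S)"
  by (simp add: ordered_tuples_def tuples_def)

lemma latest_ordered:
  assumes Q: "Q \<in> ordered_tuples M i (after S)" and i: "1 \<le> i"
  shows "AE \<omega> in M. latest Q \<omega> = last Q \<omega>" "latest Q \<in> strats"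
proof -
  have ne: "Q \<noteq> []" and sub: "set Q \<subseteq> after S"
    using Q i by (auto simp: ordered_tuples_def tuples_def)
  have "AE \<omega> in M. \<forall>\<tau>\<in>set Q. \<tau> \<omega> \<le> last Q \<omega>"
    by (rule AE_finite_allI) (simp_all add: ordered_last(3)[OF Q i])
  then show eq: "AE \<omega> in M. latest Q \<omega> = last Q \<omega>"
  proof eventually_elim
    case (elim \<omega>)
    then show ?case unfolding latest_def using ne by (intro Max_eqI) auto
  qed
  have hl: "hst (last Q)" using ordered_last(2)[OF Q i] by (rule hstD)
  have "hst (latest Q)"
  proof (rule hst_AE[OF hl])
    show "AE \<omega> in M. last Q \<omega> = latest Q \<omega>" using eq by eventually_elim simp
    fix \<omega> assume \<omega>: "\<omega> \<in> space M"
    have "latest Q \<omega> \<in> (\<lambda>\<tau>. \<tau> \<omega>) ` set Q" unfolding latest_def using ne by (intro Max_in) auto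
    then obtain \<tau> where "\<tau> \<in> set Q" "latest Q \<omega> = \<tau> \<omega>" by auto
    then show "latest Q \<omega> \<in> {0..T}" using hst_range[OF hstD[OF afterD(1)] \<omega>, of \<tau> S] sub by auto
  qed
  then show "latest Q \<in> strats"
    by (rule stratsI[of _ "[last Q]"]) (use eq ordered_last(2)[OF Q i] in simp_all)
qed

end

section \<open>Locality of the operators\<close>

context bermudan_operators
begin

lemma rho_cong:
  assumes "S \<in> strats" "\<tau> \<in> strats" "\<eta> \<in> Lp M p (Fs \<tau>)" "\<eta>' \<in> Lp M p (Fs \<tau>)"
    and eq: "AE \<omega> in M. \<eta> \<omega> = \<eta>' \<omega>"
  shows "AE \<omega> in M. \<rho> S \<tau> \<eta> \<omega> = \<rho> S \<tau> \<eta>' \<omega>"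
proof -
  have "AE \<omega> in M. \<eta> \<omega> \<le> \<eta>' \<omega>" "AE \<omega> in M. \<eta>' \<omega> \<le> \<eta> \<omega>"
    using eq by (eventually_elim, simp)+
  then have "AE \<omega> in M. \<rho> S \<tau> \<eta> \<omega> \<le> \<rho> S \<tau> \<eta>' \<omega>" "AE \<omega> in M. \<rho> S \<tau> \<eta>' \<omega> \<le> \<rho> S \<tau> \<eta> \<omega>"
    using assms monotonicity by blast+
  then show ?thesis by eventually_elim simp
qed

text \<open>The evaluation time \<open>\<tau>\<close> matters only up to null sets: consistency inserts \<open>\<tau>'\<close> between \<open>S\<close> and \<open>\<tau>\<close>,
  and \<open>\<rho> \<tau>' \<tau>\<close> acts as the identity by knowledge preservation, since also \<open>\<tau> \<le> \<tau>'\<close>.\<close>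

lemma rho_cong_time:
  assumes S: "S \<in> strats" and \<tau>: "\<tau> \<in> after S" and \<tau>': "\<tau>' \<in> strats"
    and eq: "AE \<omega> in M. \<tau> \<omega> = \<tau>' \<omega>" and \<eta>: "\<eta> \<in> Lp M p (Fs \<tau>)"
  shows "AE \<omega> in M. \<rho> S \<tau> \<eta> \<omega> = \<rho> S \<tau>' \<eta> \<omega>"
proof -
  note \<tau>s = afterD(1)[OF \<tau>]
  have le: "AE \<omega> in M. \<tau> \<omega> \<le> \<tau>' \<omega>" "AE \<omega> in M. \<tau>' \<omega> \<le> \<tau> \<omega>"
    using eq by (eventually_elim, simp)+
  have le': "AE \<omega> in M. S \<omega> \<le> \<tau>' \<omega>"
    using afterD(2)[OF \<tau>] le(1) by eventually_elim simp
  have "AE \<omega> in M. \<rho> \<tau>' \<tau> \<eta> \<omega> = \<eta> \<omega>"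
    by (rule knowledge_preservation[OF \<tau>s afterI[OF \<tau>' le(1)] \<eta>])
  moreover have "\<eta> \<in> Lp M p (Fs \<tau>')"
    by (rule Lp_mono[OF \<eta> hstD[OF \<tau>s] hstD[OF \<tau>'] le(1)])
  ultimately have "AE \<omega> in M. \<rho> S \<tau>' (\<rho> \<tau>' \<tau> \<eta>) \<omega> = \<rho> S \<tau>' \<eta> \<omega>"
    using maps_Lp[OF \<tau>' \<tau>s \<eta>] by (intro rho_cong[OF S \<tau>'])
  moreover have "AE \<omega> in M. \<rho> S \<tau>' (\<rho> \<tau>' \<tau> \<eta>) \<omega> = \<rho> S \<tau> \<eta> \<omega>"
    by (rule consistency[OF S \<tau>' \<tau>s le' le(2) \<eta>])
  ultimately show ?thesis by eventually_elim simp
qed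

lemma latest_pair: "latest [\<sigma>, \<tau>] = sup \<sigma> \<tau>"
  by (simp add: latest_def fun_eq_iff sup_real_def)

text \<open>Apply the first two-parameter law to the family that pays \<open>\<eta>\<close> where its arguments are \<open>S\<close> and \<open>\<nu>\<close>, and
  \<open>0\<close> elsewhere. Its member at \<open>(S, \<nu>)\<close> is \<open>\<eta>\<close>, its member at \<open>(S', \<nu>)\<close> has lost all values of \<open>\<eta>\<close> off
  \<open>{S = S'}\<close>.\<close>

lemma rho_transport:
  assumes S: "S \<in> strats" and S': "S' \<in> strats" and \<nu>: "\<nu> \<in> after S" and \<eta>: "\<eta> \<in> Lp M p (Fs \<nu>)"
  shows "AE \<omega> in M. S \<omega> = S' \<omega> \<longrightarrow>
    \<rho> S \<nu> \<eta> \<omega> = \<rho> S' (sup S' \<nu>) (\<lambda>\<omega>. if S \<omega> = S' \<omega> then \<eta> \<omega> else 0) \<omega>"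
proof -
  note \<nu>s = afterD(1)[OF \<nu>]
  define X where "X xs \<omega> = (if S \<omega> = (xs ! 0) \<omega> \<and> \<nu> \<omega> = (xs ! 1) \<omega> then \<eta> \<omega> else 0)"
    for xs :: "('a \<Rightarrow> real) list" and \<omega>
  have pair: "\<exists>\<sigma> \<kappa>. xs = [\<sigma>, \<kappa>] \<and> \<sigma> \<in> strats \<and> \<kappa> \<in> strats" if "xs \<in> tuples 2 strats" for xs
    using that by (auto simp: tuples_def length_Suc_conv numeral_2_eq_2)
  have X_Lp: "X [\<sigma>, \<kappa>] \<in> Lp M p (Fs (sup \<sigma> \<kappa>))" if \<sigma>: "\<sigma> \<in> strats" and \<kappa>: "\<kappa> \<in> strats" for \<sigma> \<kappa>
  proof -
    note h = hstD[OF \<sigma>] hstD[OF \<kappa>] hstD[OF S] hstD[OF \<nu>s]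
    note hs = hst_max[OF h(1,2)]
    have "(\<lambda>\<omega>. if \<nu> \<omega> = sup \<sigma> \<kappa> \<omega> then \<eta> \<omega> else 0) \<in> Lp M p (Fs (sup \<sigma> \<kappa>))"
      by (rule Lp_on_eq[OF hs h(4) \<eta>])
    moreover have "Measurable.pred (Fs (sup \<sigma> \<kappa>)) (\<lambda>\<omega>. S \<omega> = \<sigma> \<omega> \<and> \<nu> \<omega> = \<kappa> \<omega>)"
      using pred_eq_Fs[OF h(3,1) hs] pred_eq_Fs[OF h(4,2) hs] by (intro pred_intros_logic(3)) auto
    ultimately have 1: "(\<lambda>\<omega>. if S \<omega> = \<sigma> \<omega> \<and> \<nu> \<omega> = \<kappa> \<omega> then
        if \<nu> \<omega> = sup \<sigma> \<kappa> \<omega> then \<eta> \<omega> else 0 else 0) \<in> Lp M p (Fs (sup \<sigma> \<kappa>))"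
      by (rule Lp_indicator[OF _ hs])
    show ?thesis
    proof (rule Lp_AE[OF 1 hs])
      show "AE \<omega> in M. (if S \<omega> = \<sigma> \<omega> \<and> \<nu> \<omega> = \<kappa> \<omega> then
        if \<nu> \<omega> = sup \<sigma> \<kappa> \<omega> then \<eta> \<omega> else 0 else 0) = X [\<sigma>, \<kappa>] \<omega>"
        using afterD(2)[OF \<nu>] by eventually_elim (auto simp: X_def sup_real_def)
    qed
  qed
  have adm: "multi_admissible M T F \<theta> 2 X"
    unfolding multi_admissible_def
  proof (intro conjI ballI)
    fix xs assume xs: "xs \<in> tuples 2 strats"
    show "X xs \<in> borel_measurable (Fs (latest xs))"
      using pair[OF xs] X_Lp by (auto simp: latest_pair Lp_def)
    fix ys
    show "AE \<omega> in M. (\<forall>i<2. (xs ! i) \<omega> = (ys ! i) \<omega>) \<longrightarrow> X xs \<omega> = X ys \<omega>"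
      by (rule AE_I2) (simp add: X_def)
  qed
  have int: "p_integrable M p (tuples 2 strats) X"
    unfolding p_integrable_def
  proof
    fix xs assume "xs \<in> tuples 2 strats"
    then obtain \<sigma> \<kappa> where xs: "xs = [\<sigma>, \<kappa>]" "\<sigma> \<in> strats" "\<kappa> \<in> strats" using pair by blast
    show "X xs \<in> Lp M p M"
      using X_Lp[OF xs(2,3)] Lp_Fs_iff[OF hst_max[OF hstD[OF xs(2)] hstD[OF xs(3)]]] xs(1) by blast
  qed
  have law: "AE \<omega> in M. S \<omega> = S' \<omega> \<longrightarrow>
      \<rho> S (sup S \<nu>) (X [S, \<nu>]) \<omega> = \<rho> S' (sup S' \<nu>) (X [S', \<nu>]) \<omega>"
    by (rule bi_law_1[OF adm int S S' \<nu>s])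
  have X1: "X [S, \<nu>] = \<eta>" and X2: "X [S', \<nu>] = (\<lambda>\<omega>. if S \<omega> = S' \<omega> then \<eta> \<omega> else 0)"
    by (auto simp: X_def fun_eq_iff)
  have "AE \<omega> in M. \<nu> \<omega> = sup S \<nu> \<omega>"
    using afterD(2)[OF \<nu>] by eventually_elim (simp add: sup_real_def)
  then have "AE \<omega> in M. \<rho> S \<nu> \<eta> \<omega> = \<rho> S (sup S \<nu>) \<eta> \<omega>"
    by (rule rho_cong_time[OF S \<nu> strats_sup[OF S \<nu>s] _ \<eta>])
  with law show ?thesis unfolding X1 X2 by eventually_elim simp
qed

text \<open>The laws that restrict an evaluation to an event compare payoffs only within an admissible family.
  The events isolated here allow a comparison of arbitrary payoffs; unlike \<open>{S = S*}\<close> itself, they are visibly closed under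
  intersections.\<close>

definition local_at :: "('a \<Rightarrow> real) \<Rightarrow> ('a \<Rightarrow> bool) \<Rightarrow> bool" where
  "local_at S P \<longleftrightarrow> Measurable.pred (Fs S) P \<and>
     (\<forall>\<tau>\<in>after S. \<forall>\<eta>\<in>Lp M p (Fs \<tau>). \<forall>\<eta>'\<in>Lp M p (Fs \<tau>).
        (AE \<omega> in M. P \<omega> \<longrightarrow> \<eta> \<omega> = \<eta>' \<omega>) \<longrightarrow> (AE \<omega> in M. P \<omega> \<longrightarrow> \<rho> S \<tau> \<eta> \<omega> = \<rho> S \<tau> \<eta>' \<omega>))"

lemma local_atD:
  assumes "local_at S P" "\<tau> \<in> after S" "\<eta> \<in> Lp M p (Fs \<tau>)" "\<eta>' \<in> Lp M p (Fs \<tau>)"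
    "AE \<omega> in M. P \<omega> \<longrightarrow> \<eta> \<omega> = \<eta>' \<omega>"
  shows "AE \<omega> in M. P \<omega> \<longrightarrow> \<rho> S \<tau> \<eta> \<omega> = \<rho> S \<tau> \<eta>' \<omega>"
  using assms unfolding local_at_def by blast

lemma local_at_pred: "local_at S P \<Longrightarrow> Measurable.pred (Fs S) P"
  by (simp add: local_at_def)

lemma local_at_True:
  assumes "S \<in> strats" shows "local_at S (\<lambda>_. True)"
  unfolding local_at_def using rho_cong[OF assms] afterD(1) by auto

text \<open>Both payoffs have the same image under \<open>rho_transport\<close>.\<close>

lemma local_at_eq:
  assumes S: "S \<in> strats" and S': "S' \<in> strats"
  shows "local_at S (\<lambda>\<omega>. S \<omega> = S' \<omega>)"
  unfolding local_at_def
proof (intro conjI ballI impI)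
  show "Measurable.pred (Fs S) (\<lambda>\<omega>. S \<omega> = S' \<omega>)"
    by (rule pred_eq_Fs[OF hstD[OF S] hstD[OF S'] hstD[OF S]]) simp
  fix \<tau> \<eta> \<eta>'
  assume \<tau>: "\<tau> \<in> after S" and \<eta>: "\<eta> \<in> Lp M p (Fs \<tau>)" and \<eta>': "\<eta>' \<in> Lp M p (Fs \<tau>)"
    and eq: "AE \<omega> in M. S \<omega> = S' \<omega> \<longrightarrow> \<eta> \<omega> = \<eta>' \<omega>"
  note h = hstD[OF S] hstD[OF S'] hstD[OF afterD(1)[OF \<tau>]]
  let ?r = "\<lambda>\<eta> \<omega>. if S \<omega> = S' \<omega> then \<eta> \<omega> else (0 :: real)"
  have "?r \<eta> \<in> Lp M p (Fs (sup S' \<tau>))" if "\<eta> \<in> Lp M p (Fs \<tau>)" for \<eta>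
  proof (rule Lp_indicator)
    show "\<eta> \<in> Lp M p (Fs (sup S' \<tau>))"
      by (rule Lp_mono[OF that h(3) hst_max[OF h(2,3)]]) simp
    show "Measurable.pred (Fs (sup S' \<tau>)) (\<lambda>\<omega>. S \<omega> = S' \<omega>)"
      by (rule pred_eq_Fs[OF h(1,2) hst_max[OF h(2,3)]]) simp
  qed (rule hst_max[OF h(2,3)])
  moreover have "AE \<omega> in M. ?r \<eta> \<omega> = ?r \<eta>' \<omega>" using eq by eventually_elim simp
  ultimately have "AE \<omega> in M. \<rho> S' (sup S' \<tau>) (?r \<eta>) \<omega> = \<rho> S' (sup S' \<tau>) (?r \<eta>') \<omega>"
    using \<eta> \<eta>' by (intro rho_cong[OF S' strats_sup[OF S' afterD(1)[OF \<tau>]]])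
  with rho_transport[OF S S' \<tau> \<eta>] rho_transport[OF S S' \<tau> \<eta>']
  show "AE \<omega> in M. S \<omega> = S' \<omega> \<longrightarrow> \<rho> S \<tau> \<eta> \<omega> = \<rho> S \<tau> \<eta>' \<omega>" by eventually_elim simp
qed

text \<open>The payoff that equals \<open>\<eta>\<close> on \<open>P\<close> and \<open>\<eta>'\<close> off \<open>P\<close> agrees with \<open>\<eta>\<close> on \<open>P\<close>
  and, if \<open>\<eta> = \<eta>'\<close> on the intersection, with \<open>\<eta>'\<close> on \<open>Q\<close>.\<close>

lemma local_at_conj:
  assumes S: "S \<in> strats" and P: "local_at S P" and Q: "local_at S Q"
  shows "local_at S (\<lambda>\<omega>. P \<omega> \<and> Q \<omega>)"
  unfolding local_at_def
proof (intro conjI ballI impI)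
  show "Measurable.pred (Fs S) (\<lambda>\<omega>. P \<omega> \<and> Q \<omega>)"
    by (rule pred_intros_logic(3)[OF local_at_pred[OF P] local_at_pred[OF Q]])
  fix \<tau> \<eta> \<eta>'
  assume \<tau>: "\<tau> \<in> after S" and \<eta>: "\<eta> \<in> Lp M p (Fs \<tau>)" and \<eta>': "\<eta>' \<in> Lp M p (Fs \<tau>)"
    and eq: "AE \<omega> in M. P \<omega> \<and> Q \<omega> \<longrightarrow> \<eta> \<omega> = \<eta>' \<omega>"
  let ?m = "\<lambda>\<omega>. if P \<omega> then \<eta> \<omega> else \<eta>' \<omega>"
  have "Measurable.pred (Fs \<tau>) P"
    by (rule measurable_Fs_mono[OF local_at_pred[OF P] hstD[OF S] hstD[OF afterD(1)[OF \<tau>]] afterD(2)[OF \<tau>]])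
  then have m: "?m \<in> Lp M p (Fs \<tau>)" by (rule Lp_if[OF \<eta> \<eta>' hstD[OF afterD(1)[OF \<tau>]]])
  have "AE \<omega> in M. P \<omega> \<longrightarrow> \<rho> S \<tau> \<eta> \<omega> = \<rho> S \<tau> ?m \<omega>"
    by (rule local_atD[OF P \<tau> \<eta> m]) simp
  moreover have "AE \<omega> in M. Q \<omega> \<longrightarrow> \<rho> S \<tau> ?m \<omega> = \<rho> S \<tau> \<eta>' \<omega>"
    by (rule local_atD[OF Q \<tau> m \<eta>']) (use eq in eventually_elim, simp)
  ultimately show "AE \<omega> in M. P \<omega> \<and> Q \<omega> \<longrightarrow> \<rho> S \<tau> \<eta> \<omega> = \<rho> S \<tau> \<eta>' \<omega>" by eventually_elim simp
qed

lemma local_at_AE: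
  assumes S: "S \<in> strats" and P: "local_at S P" and eq: "AE \<omega> in M. P \<omega> \<longleftrightarrow> Q \<omega>"
  shows "local_at S Q"
  unfolding local_at_def
proof (intro conjI ballI impI)
  have "{\<omega>\<in>space M. Q \<omega>} \<in> sets (Fs S)"
    by (rule sets_Fs_AE[OF hstD[OF S], of "{\<omega>\<in>space M. P \<omega>}"])
      (use local_at_pred[OF P] eq in \<open>auto simp: pred_def\<close>)
  then show "Measurable.pred (Fs S) Q" by (simp add: pred_def)
  fix \<tau> \<eta> \<eta>'
  assume \<tau>: "\<tau> \<in> after S" and \<eta>: "\<eta> \<in> Lp M p (Fs \<tau>)" and \<eta>': "\<eta>' \<in> Lp M p (Fs \<tau>)"
    and eq': "AE \<omega> in M. Q \<omega> \<longrightarrow> \<eta> \<omega> = \<eta>' \<omega>"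
  have "AE \<omega> in M. P \<omega> \<longrightarrow> \<eta> \<omega> = \<eta>' \<omega>" using eq' eq by eventually_elim simp
  then have "AE \<omega> in M. P \<omega> \<longrightarrow> \<rho> S \<tau> \<eta> \<omega> = \<rho> S \<tau> \<eta>' \<omega>" by (rule local_atD[OF P \<tau> \<eta> \<eta>'])
  then show "AE \<omega> in M. Q \<omega> \<longrightarrow> \<rho> S \<tau> \<eta> \<omega> = \<rho> S \<tau> \<eta>' \<omega>" using eq by eventually_elim simp
qed

text \<open>For the change from \<open>\<tau>\<close> to \<open>\<tau>'\<close> the zero-one law applies to the family that pays \<open>\<eta>\<close> on \<open>P\<close> where its
  argument is \<open>\<tau>\<close>, and \<open>0\<close> elsewhere; locality lets this family replace \<open>\<eta>\<close> and \<open>\<eta>'\<close>.\<close>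

lemma local_at_time:
  assumes S: "S \<in> strats" and P: "local_at S P" and \<tau>: "\<tau> \<in> after S" and \<tau>': "\<tau>' \<in> after S"
    and \<eta>: "\<eta> \<in> Lp M p (Fs \<tau>)" and \<eta>': "\<eta>' \<in> Lp M p (Fs \<tau>')"
    and eq_time: "AE \<omega> in M. P \<omega> \<longrightarrow> \<tau> \<omega> = \<tau>' \<omega>" and eq: "AE \<omega> in M. P \<omega> \<longrightarrow> \<eta> \<omega> = \<eta>' \<omega>"
  shows "AE \<omega> in M. P \<omega> \<longrightarrow> \<rho> S \<tau> \<eta> \<omega> = \<rho> S \<tau>' \<eta>' \<omega>"
proof -
  note h = hstD[OF afterD(1)[OF \<tau>]] hstD[OF afterD(1)[OF \<tau>']]
  define \<xi> where "\<xi> \<sigma> \<omega> = (if \<tau> \<omega> = \<sigma> \<omega> then if P \<omega> then \<eta> \<omega> else 0 else 0)"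
    for \<sigma> :: "'a \<Rightarrow> real" and \<omega>
  have "Measurable.pred (Fs \<tau>) P"
    by (rule measurable_Fs_mono[OF local_at_pred[OF P] hstD[OF S] h(1) afterD(2)[OF \<tau>]])
  then have "(\<lambda>\<omega>. if P \<omega> then \<eta> \<omega> else 0) \<in> Lp M p (Fs \<tau>)" by (rule Lp_indicator[OF \<eta> h(1)])
  then have \<xi>: "\<xi> \<sigma> \<in> Lp M p (Fs \<sigma>)" if "\<sigma> \<in> strats" for \<sigma>
    unfolding \<xi>_def using hstD[OF that] h(1) by (intro Lp_on_eq)
  then have "p_integrable M p strats \<xi>"
    unfolding p_integrable_def using Lp_Fs_iff[OF hstD] by blast
  moreover have "admissible M T F \<theta> \<xi>"
    using \<xi> by (auto simp: admissible_def Lp_def \<xi>_def intro!: AE_I2)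
  moreover have "{\<omega>\<in>space M. P \<omega>} \<in> sets (Fs S)" using local_at_pred[OF P] by (simp add: pred_def)
  moreover have "AE \<omega> in M. \<omega> \<in> {\<omega>\<in>space M. P \<omega>} \<longrightarrow> \<tau> \<omega> = \<tau>' \<omega>"
    using eq_time by eventually_elim simp
  ultimately have "AE \<omega> in M. \<omega> \<in> {\<omega>\<in>space M. P \<omega>} \<longrightarrow> \<rho> S \<tau> (\<xi> \<tau>) \<omega> = \<rho> S \<tau>' (\<xi> \<tau>') \<omega>"
    using zero_one_law[OF _ _ S _ \<tau> \<tau>'] by blast
  moreover have "AE \<omega> in M. P \<omega> \<longrightarrow> \<rho> S \<tau> \<eta> \<omega> = \<rho> S \<tau> (\<xi> \<tau>) \<omega>"
    by (rule local_atD[OF P \<tau> \<eta> \<xi>[OF afterD(1)[OF \<tau>]]]) (simp add: \<xi>_def)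
  moreover have "AE \<omega> in M. P \<omega> \<longrightarrow> \<rho> S \<tau>' (\<xi> \<tau>') \<omega> = \<rho> S \<tau>' \<eta>' \<omega>"
    by (rule local_atD[OF P \<tau>' \<xi>[OF afterD(1)[OF \<tau>']] \<eta>'])
      (use eq_time eq in \<open>eventually_elim, simp add: \<xi>_def\<close>)
  ultimately show ?thesis using AE_space by eventually_elim simp
qed

text \<open>Let \<open>s\<close> and \<open>s'\<close> be the last times of the tuples, and \<open>a\<close> and \<open>b\<close> their \<open>j\<close>-th times. The strategy that
  equals \<open>s'\<close> where \<open>a = b\<close>, and \<open>min a b\<close> elsewhere, detects \<open>a = b\<close>: where \<open>s = s'\<close> and \<open>a \<noteq> b\<close>, the minimum is
  strictly below \<open>max a b \<le> s'\<close>. So \<open>s = s'\<close> and \<open>a = b\<close> together hold exactly where \<open>s'\<close> equals \<open>s\<close> and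
  this strategy.\<close>

lemma local_at_tuples_eq:
  assumes Q: "Q \<in> ordered_tuples M i (after S)" and Q': "Q' \<in> ordered_tuples M i (after S)"
    and i: "1 \<le> i"
  shows "local_at (last Q') (\<lambda>\<omega>. \<forall>j<i. (Q ! j) \<omega> = (Q' ! j) \<omega>)"
proof -
  let ?s = "last Q" and ?s' = "last Q'"
  have len: "length Q = i" "length Q' = i" and sub: "set Q \<subseteq> after S" "set Q' \<subseteq> after S"
    using Q Q' by (auto simp: ordered_tuples_def tuples_def)
  note s = ordered_last(2)[OF Q i] and s' = ordered_last(2)[OF Q' i]
  have L: "local_at ?s' (\<lambda>\<omega>. ?s' \<omega> = ?s \<omega> \<and> (Q ! j) \<omega> = (Q' ! j) \<omega>)" if j: "j < i" for j
  proof -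
    let ?a = "Q ! j" and ?b = "Q' ! j"
    have in_set: "?a \<in> set Q" "?b \<in> set Q'" using j len by auto
    then have ab: "?a \<in> strats" "?b \<in> strats" using sub afterD(1) by blast+
    have le: "AE \<omega> in M. ?a \<omega> \<le> ?s \<omega>" "AE \<omega> in M. ?b \<omega> \<le> ?s' \<omega>"
      using ordered_last(3)[OF Q i] ordered_last(3)[OF Q' i] in_set by blast+
    let ?r = "\<lambda>\<omega>. if ?a \<omega> = ?b \<omega> then ?s' \<omega> else inf ?a ?b \<omega>"
    have "?r \<in> strats"
    proof (rule strats_paste[OF s' strats_inf[OF ab]])
      show "Measurable.pred (Fs ?s') (\<lambda>\<omega>. ?a \<omega> = ?b \<omega>)"
        by (rule pred_eq_Fs[OF hstD[OF ab(1)] hstD[OF ab(2)] hstD[OF s']])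
          (use le(2) in \<open>eventually_elim, simp\<close>)
      show "Measurable.pred (Fs (inf ?a ?b)) (\<lambda>\<omega>. ?a \<omega> = ?b \<omega>)"
        by (rule pred_eq_Fs_min[OF hstD[OF ab(1)] hstD[OF ab(2)]])
    qed
    then have "local_at ?s' (\<lambda>\<omega>. ?s' \<omega> = ?s \<omega> \<and> ?s' \<omega> = ?r \<omega>)"
      by (intro local_at_conj[OF s'] local_at_eq[OF s'] s)
    then show ?thesis
    proof (rule local_at_AE[OF s'])
      show "AE \<omega> in M. (?s' \<omega> = ?s \<omega> \<and> ?s' \<omega> = ?r \<omega>) \<longleftrightarrow> (?s' \<omega> = ?s \<omega> \<and> ?a \<omega> = ?b \<omega>)"
        using le by eventually_elim (auto simp: inf_real_def)
    qed
  qed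
  have "local_at ?s' (\<lambda>\<omega>. \<forall>j<n. ?s' \<omega> = ?s \<omega> \<and> (Q ! j) \<omega> = (Q' ! j) \<omega>)" if "n \<le> i" for n
    using that
  proof (induction n)
    case 0
    then show ?case using local_at_True[OF s'] by simp
  next
    case (Suc n)
    then show ?case
      using local_at_conj[OF s' Suc.IH L[of n]] by (simp add: All_less_Suc conj_commute)
  qed
  then have "local_at ?s' (\<lambda>\<omega>. \<forall>j<i. ?s' \<omega> = ?s \<omega> \<and> (Q ! j) \<omega> = (Q' ! j) \<omega>)" by simp
  moreover have "?s = Q ! (i - 1)" "?s' = Q' ! (i - 1)"
    using len i by (auto simp: last_conv_nth simp flip: length_greater_0_conv)
  then have "(\<forall>j<i. ?s' \<omega> = ?s \<omega> \<and> (Q ! j) \<omega> = (Q' ! j) \<omega>) \<longleftrightarrow> (\<forall>j<i. (Q ! j) \<omega> = (Q' ! j) \<omega>)" for \<omega>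
    using i by auto
  ultimately show ?thesis by simp
qed

end

section \<open>The backward recursion\<close>

locale multiple_stopping = bermudan_operators M T F \<theta> p d \<rho>
  for M :: "'a measure" and T F \<theta> p d \<rho> +
  fixes \<psi> :: "('a \<Rightarrow> real) list \<Rightarrow> 'a \<Rightarrow> real" and S :: "'a \<Rightarrow> real"
  assumes d2: "2 \<le> d"
    and sym: "symmetric_family M strats d \<psi>"
    and adm: "multi_admissible M T F \<theta> d \<psi>"
    and int: "p_integrable M p (tuples d strats) \<psi>"
    and S: "S \<in> strats"
    and phi_Lp: "\<And>i Ss. i \<in> {1..d - 1} \<Longrightarrow> Ss \<in> ordered_tuples M i (after S) \<Longrightarrow>
      in_Lp_ereal M p (phi M strats \<rho> d \<psi> Ss)"
begin

abbreviation Ord :: "nat \<Rightarrow> ('a \<Rightarrow> real) list set" where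
  "Ord i \<equiv> ordered_tuples M i (after S)"

abbreviation \<phi> :: "('a \<Rightarrow> real) list \<Rightarrow> 'a \<Rightarrow> ereal" where
  "\<phi> \<equiv> phi M strats \<rho> d \<psi>"

text \<open>Extending \<open>\<phi>\<^sub>i\<close> by \<open>\<phi>\<^sub>d = \<psi>\<close> makes the two cases of the recursion one (\<open>phi_eq_ess_SUP_gain\<close>).\<close>

definition reward :: "('a \<Rightarrow> real) list \<Rightarrow> 'a \<Rightarrow> real" where
  "reward Q = (if length Q < d then \<lambda>\<omega>. real_of_ereal (\<phi> Q \<omega>) else \<psi> Q)"

definition gain :: "('a \<Rightarrow> real) list \<Rightarrow> ('a \<Rightarrow> real) \<Rightarrow> 'a \<Rightarrow> real" where
  "gain Q \<tau> = \<rho> (last Q) \<tau> (reward (Q @ [\<tau>]))"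

lemma Ord_length: "Q \<in> Ord i \<Longrightarrow> length Q = i"
  by (simp add: ordered_tuples_def tuples_def)

lemma Ord_tuples: "Q \<in> Ord i \<Longrightarrow> Q \<in> tuples i (after S)"
  by (simp add: ordered_tuples_def)

lemma tuples_after: "tuples i (after S) \<subseteq> tuples i strats"
  using afterD(1) by (auto simp: tuples_def)

lemma phi_eq_ess_SUP_gain:
  assumes "Q \<in> Ord i" "i < d"
  shows "\<phi> Q = ess_SUP M (after (last Q)) (gain Q)"
proof (cases "length Q + 1 < d")
  case True
  then show ?thesis by (subst phi.simps) (simp add: gain_def [abs_def] reward_def)
next
  case False
  then have "length Q + 1 = d" using assms Ord_length by fastforce
  then show ?thesis by (subst phi.simps) (simp add: gain_def [abs_def] reward_def)
qed

lemma phi_finite: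
  assumes "Q \<in> Ord i" "1 \<le> i" "i < d"
  shows "AE \<omega> in M. \<phi> Q \<omega> = ereal (reward Q \<omega>)"
proof -
  have "AE \<omega> in M. \<bar>\<phi> Q \<omega>\<bar> \<noteq> \<infinity>"
    using phi_Lp[of i Q] assms by (auto simp: in_Lp_ereal_def)
  then show ?thesis
    by eventually_elim (use assms Ord_length[OF assms(1)] in \<open>simp add: reward_def ereal_real\<close>)
qed

text \<open>The properties of the rewards of ordered \<open>i\<close>-tuples that the backward induction carries along:
  they can be evaluated by the operators, and they are admissible in all arguments jointly.\<close>

definition regular :: "nat \<Rightarrow> bool" where
  "regular i \<longleftrightarrow> (\<forall>Q\<in>Ord i. reward Q \<in> Lp M p (Fs (last Q))) \<and>
     (\<forall>Q\<in>Ord i. \<forall>Q'\<in>Ord i.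
        AE \<omega> in M. (\<forall>j<i. (Q ! j) \<omega> = (Q' ! j) \<omega>) \<longrightarrow> reward Q \<omega> = reward Q' \<omega>)"

lemma regular_Lp: "regular i \<Longrightarrow> Q \<in> Ord i \<Longrightarrow> reward Q \<in> Lp M p (Fs (last Q))"
  by (simp add: regular_def)

lemma regular_append_Lp:
  assumes "regular (Suc i)" "Q \<in> Ord i" "1 \<le> i" "\<tau> \<in> after (last Q)"
  shows "reward (Q @ [\<tau>]) \<in> Lp M p (Fs \<tau>)"
  using regular_Lp[OF assms(1) ordered_append[OF assms(2,3,4)]] by simp

lemma regular_append_cong:
  assumes reg: "regular (Suc i)" and Q: "Q \<in> Ord i" "Q' \<in> Ord i" and i: "1 \<le> i"
    and \<tau>: "\<tau> \<in> after (last Q)" "\<tau>' \<in> after (last Q')"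
  shows "AE \<omega> in M. (\<forall>j<i. (Q ! j) \<omega> = (Q' ! j) \<omega>) \<and> \<tau> \<omega> = \<tau>' \<omega> \<longrightarrow>
    reward (Q @ [\<tau>]) \<omega> = reward (Q' @ [\<tau>']) \<omega>"
proof -
  have "AE \<omega> in M. (\<forall>j<Suc i. ((Q @ [\<tau>]) ! j) \<omega> = ((Q' @ [\<tau>']) ! j) \<omega>) \<longrightarrow>
      reward (Q @ [\<tau>]) \<omega> = reward (Q' @ [\<tau>']) \<omega>"
    using reg ordered_append[OF Q(1) i \<tau>(1)] ordered_append[OF Q(2) i \<tau>(2)]
    unfolding regular_def by blast
  then show ?thesis
    by eventually_elim
      (use Ord_length[OF Q(1)] Ord_length[OF Q(2)] in \<open>simp add: nth_append All_less_Suc\<close>)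
qed

lemma gain_Lp:
  assumes "regular (Suc i)" "Q \<in> Ord i" "1 \<le> i" "\<tau> \<in> after (last Q)"
  shows "gain Q \<tau> \<in> Lp M p (Fs (last Q))"
  unfolding gain_def
  by (rule maps_Lp[OF ordered_last(2)[OF assms(2,3)] afterD(1)[OF assms(4)] regular_append_Lp[OF assms]])

lemma gain_measurable:
  assumes "regular (Suc i)" "Q \<in> Ord i" "1 \<le> i" "\<tau> \<in> after (last Q)"
  shows "gain Q \<tau> \<in> borel_measurable (Fs (last Q))" "gain Q \<tau> \<in> borel_measurable M"
proof -
  show "gain Q \<tau> \<in> borel_measurable (Fs (last Q))" using gain_Lp[OF assms] by (simp add: Lp_def)
  then show "gain Q \<tau> \<in> borel_measurable M" by (rule Fs_into_M[OF hstD[OF ordered_last(2)[OF assms(2,3)]]])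
qed

lemma is_ess_SUP_phi:
  assumes "regular (Suc i)" "Q \<in> Ord i" "1 \<le> i" "i < d"
  shows "is_ess_SUP M (after (last Q)) (gain Q) (\<phi> Q)"
  unfolding phi_eq_ess_SUP_gain[OF assms(2,4)]
  by (rule is_ess_SUP_ess_SUP) (rule gain_measurable(2)[OF assms(1-3)])

text \<open>On the event \<open>B\<close> where the tuples coincide, a continuation \<open>\<nu>\<close> of \<open>Q\<close> can be imitated as a
  continuation of \<open>Q'\<close>: follow \<open>\<nu>\<close> on \<open>B\<close> and stop at \<open>T\<close> elsewhere. Both have the same evaluation on \<open>B\<close>:
  transport moves the first one from \<open>last Q\<close> to \<open>last Q'\<close>, and \<open>B\<close> is local at \<open>last Q'\<close>.\<close>

lemma phi_mono_on_eq:
  assumes reg: "regular (Suc i)" and Q: "Q \<in> Ord i" and Q': "Q' \<in> Ord i" and i: "1 \<le> i" "i < d"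
  shows "AE \<omega> in M. (\<forall>j<i. (Q ! j) \<omega> = (Q' ! j) \<omega>) \<longrightarrow> \<phi> Q \<omega> \<le> \<phi> Q' \<omega>"
proof -
  let ?s = "last Q" and ?s' = "last Q'"
  define B where "B \<omega> \<longleftrightarrow> (\<forall>j<i. (Q ! j) \<omega> = (Q' ! j) \<omega>)" for \<omega>
  note s = ordered_last(2)[OF Q i(1)] and s' = ordered_last(2)[OF Q' i(1)]
  have loc: "local_at ?s' B" and loc': "local_at ?s B"
    using local_at_tuples_eq[OF Q Q' i(1)] local_at_tuples_eq[OF Q' Q i(1)]
    unfolding B_def by (simp_all add: eq_commute)
  have Bs: "?s \<omega> = ?s' \<omega>" if "B \<omega>" for \<omega>
  proof -
    have "?s = Q ! (i - 1)" "?s' = Q' ! (i - 1)"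
      using Ord_length[OF Q] Ord_length[OF Q'] i(1)
      by (auto simp: last_conv_nth simp flip: length_greater_0_conv)
    then show ?thesis using that i(1) by (simp add: B_def)
  qed
  have le: "AE \<omega> in M. B \<omega> \<longrightarrow> gain Q \<nu> \<omega> \<le> \<phi> Q' \<omega>" if \<nu>: "\<nu> \<in> after ?s" for \<nu>
  proof -
    note \<nu>s = afterD(1)[OF \<nu>]
    let ?\<nu>' = "\<lambda>\<omega>. if B \<omega> then \<nu> \<omega> else T"
    have "Measurable.pred (Fs \<nu>) B"
      by (rule measurable_Fs_mono[OF local_at_pred[OF loc'] hstD[OF s] hstD[OF \<nu>s] afterD(2)[OF \<nu>]])
    moreover have "Measurable.pred (Fs (\<lambda>_. T)) B"
      by (rule measurable_Fs_mono[OF local_at_pred[OF loc'] hstD[OF s] hstD[OF strats_T]])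
        (use hst_range[OF hstD[OF s]] in auto)
    ultimately have "?\<nu>' \<in> strats" by (rule strats_paste[OF \<nu>s strats_T])
    moreover have "AE \<omega> in M. ?s' \<omega> \<le> ?\<nu>' \<omega>"
      using afterD(2)[OF \<nu>] AE_space
      by eventually_elim (use hst_range[OF hstD[OF s']] Bs in auto)
    ultimately have \<nu>': "?\<nu>' \<in> after ?s'" by (rule afterI)
    have sup: "sup ?s' \<nu> \<in> after ?s'" by (rule afterI[OF strats_sup[OF s' \<nu>s]]) simp
    note hs = hstD[OF afterD(1)[OF sup]]
    let ?\<eta> = "reward (Q @ [\<nu>])" and ?\<eta>' = "reward (Q' @ [?\<nu>'])"
    note \<eta> = regular_append_Lp[OF reg Q i(1) \<nu>] and \<eta>' = regular_append_Lp[OF reg Q' i(1) \<nu>']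
    have r: "(\<lambda>\<omega>. if ?s \<omega> = ?s' \<omega> then ?\<eta> \<omega> else 0) \<in> Lp M p (Fs (sup ?s' \<nu>))"
    proof (rule Lp_indicator[OF _ hs])
      show "?\<eta> \<in> Lp M p (Fs (sup ?s' \<nu>))"
        by (rule Lp_mono[OF \<eta> hstD[OF \<nu>s] hs]) simp
      show "Measurable.pred (Fs (sup ?s' \<nu>)) (\<lambda>\<omega>. ?s \<omega> = ?s' \<omega>)"
        by (rule pred_eq_Fs[OF hstD[OF s] hstD[OF s'] hs]) simp
    qed
    have "AE \<omega> in M. ?s \<omega> = ?s' \<omega> \<longrightarrow> gain Q \<nu> \<omega> =
        \<rho> ?s' (sup ?s' \<nu>) (\<lambda>\<omega>. if ?s \<omega> = ?s' \<omega> then ?\<eta> \<omega> else 0) \<omega>"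
      unfolding gain_def by (rule rho_transport[OF s s' \<nu> \<eta>])
    moreover have "AE \<omega> in M. B \<omega> \<longrightarrow>
        \<rho> ?s' (sup ?s' \<nu>) (\<lambda>\<omega>. if ?s \<omega> = ?s' \<omega> then ?\<eta> \<omega> else 0) \<omega> = gain Q' ?\<nu>' \<omega>"
      unfolding gain_def
    proof (rule local_at_time[OF s' loc sup \<nu>' r \<eta>'])
      show "AE \<omega> in M. B \<omega> \<longrightarrow> sup ?s' \<nu> \<omega> = ?\<nu>' \<omega>"
        using afterD(2)[OF \<nu>] by eventually_elim (use Bs in \<open>auto simp: sup_real_def\<close>)
      show "AE \<omega> in M. B \<omega> \<longrightarrow> (if ?s \<omega> = ?s' \<omega> then ?\<eta> \<omega> else 0) = ?\<eta>' \<omega>"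
        using regular_append_cong[OF reg Q Q' i(1) \<nu> \<nu>']
        by eventually_elim (use Bs in \<open>auto simp: B_def\<close>)
    qed
    moreover have "AE \<omega> in M. gain Q' ?\<nu>' \<omega> \<le> \<phi> Q' \<omega>"
      using is_ess_SUP_phi[OF reg Q' i] \<nu>' by (simp add: is_ess_SUP_def)
    ultimately show ?thesis by eventually_elim (use Bs in auto)
  qed
  \<comment> \<open>the bound on \<open>B\<close> as a bound everywhere, as minimality of the essential supremum requires\<close>
  define g where "g \<omega> = (if B \<omega> then \<phi> Q' \<omega> else \<infinity>)" for \<omega>
  have "Measurable.pred M B" by (rule Fs_into_M[OF hstD[OF s'] local_at_pred[OF loc]])
  moreover have "\<phi> Q' \<in> borel_measurable M"
    using is_ess_SUP_phi[OF reg Q' i] by (simp add: is_ess_SUP_def)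
  ultimately have "g \<in> borel_measurable M"
    unfolding g_def [abs_def] by (intro measurable_If) (auto simp: pred_def)
  moreover have "AE \<omega> in M. ereal (gain Q \<nu> \<omega>) \<le> g \<omega>" if "\<nu> \<in> after ?s" for \<nu>
    using le[OF that] by eventually_elim (simp add: g_def)
  ultimately have "AE \<omega> in M. \<phi> Q \<omega> \<le> g \<omega>"
    using is_ess_SUP_phi[OF reg Q i] unfolding is_ess_SUP_def by blast
  then show ?thesis by eventually_elim (auto simp: g_def B_def split: if_splits)
qed

lemma regular_step:
  assumes reg: "regular (Suc i)" and i: "1 \<le> i" "i < d"
  shows "regular i"
  unfolding regular_def
proof (intro conjI ballI)
  fix Q assume Q: "Q \<in> Ord i"
  have "\<phi> Q \<in> borel_measurable (Fs (last Q))"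
    unfolding phi_eq_ess_SUP_gain[OF Q i(2)]
    by (rule ess_SUP_measurable_Fs[OF hstD[OF ordered_last(2)[OF Q i(1)]] gain_measurable(1)[OF reg Q i(1)]])
  moreover have "(\<lambda>\<omega>. real_of_ereal (\<phi> Q \<omega>)) \<in> Lp M p M"
    using phi_Lp[of i Q] i Q by (simp add: in_Lp_ereal_def)
  ultimately show "reward Q \<in> Lp M p (Fs (last Q))"
    using Lp_Fs_iff[OF hstD[OF ordered_last(2)[OF Q i(1)]]] Ord_length[OF Q] i(2)
    by (simp add: reward_def)
next
  fix Q Q' assume Q: "Q \<in> Ord i" and Q': "Q' \<in> Ord i"
  from phi_mono_on_eq[OF reg Q Q' i] phi_mono_on_eq[OF reg Q' Q i]
  show "AE \<omega> in M. (\<forall>j<i. (Q ! j) \<omega> = (Q' ! j) \<omega>) \<longrightarrow> reward Q \<omega> = reward Q' \<omega>"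
  proof eventually_elim
    case (elim \<omega>)
    then show ?case using Ord_length[OF Q] Ord_length[OF Q'] i(2)
      by (auto simp: reward_def intro!: arg_cong[where f = real_of_ereal] antisym)
  qed
qed

lemma psi_Lp: "\<tau>s \<in> tuples d strats \<Longrightarrow> latest \<tau>s \<in> strats \<Longrightarrow> \<psi> \<tau>s \<in> Lp M p (Fs (latest \<tau>s))"
  using adm int Lp_Fs_iff[OF hstD] by (auto simp: multi_admissible_def p_integrable_def)

lemma regular_d: "regular d"
  unfolding regular_def
proof (intro conjI ballI)
  have d1: "1 \<le> d" using d2 by simp
  fix Q assume Q: "Q \<in> Ord d"
  then have t: "Q \<in> tuples d strats" using Ord_tuples tuples_after by blast
  note l = latest_ordered[OF Q d1]
  have "AE \<omega> in M. latest Q \<omega> \<le> last Q \<omega>" using l(1) by eventually_elim simp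
  then have "\<psi> Q \<in> Lp M p (Fs (last Q))"
    by (rule Lp_mono[OF psi_Lp[OF t l(2)] hstD[OF l(2)] hstD[OF ordered_last(2)[OF Q d1]]])
  then show "reward Q \<in> Lp M p (Fs (last Q))" using Ord_length[OF Q] by (simp add: reward_def)
  fix Q' assume Q': "Q' \<in> Ord d"
  then have "Q' \<in> tuples d strats" using Ord_tuples tuples_after by blast
  then have "AE \<omega> in M. (\<forall>j<d. (Q ! j) \<omega> = (Q' ! j) \<omega>) \<longrightarrow> \<psi> Q \<omega> = \<psi> Q' \<omega>"
    using adm t by (simp add: multi_admissible_def)
  then show "AE \<omega> in M. (\<forall>j<d. (Q ! j) \<omega> = (Q' ! j) \<omega>) \<longrightarrow> reward Q \<omega> = reward Q' \<omega>"
    using Ord_length[OF Q] Ord_length[OF Q'] by (simp add: reward_def)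
qed

lemma regular:
  assumes "1 \<le> i" "i \<le> d"
  shows "regular i"
  using assms(2,1)
proof (induction i rule: inc_induct)
  case base
  show ?case by (rule regular_d)
next
  case (step n)
  show ?case by (rule regular_step[OF step.IH step.prems step.hyps(2)]) simp
qed

text \<open>Continue with \<open>a\<close> or \<open>b\<close>, whichever has the larger gain; the choice is known at \<open>last Q\<close>, so the zero-one
  law identifies the gain of the chosen continuation on each of the two events.\<close>

lemma gain_directed:
  assumes Q: "Q \<in> Ord i" and i: "1 \<le> i" "i < d"
    and a: "a \<in> after (last Q)" and b: "b \<in> after (last Q)"
  shows "\<exists>c\<in>after (last Q). AE \<omega> in M. max (gain Q a \<omega>) (gain Q b \<omega>) \<le> gain Q c \<omega>"
proof -
  let ?s = "last Q"
  have reg: "regular (Suc i)" using i by (intro regular) auto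
  note s = ordered_last(2)[OF Q i(1)]
  note as = afterD(1)[OF a] and bs = afterD(1)[OF b]
  define A where "A \<omega> \<longleftrightarrow> gain Q b \<omega> \<le> gain Q a \<omega>" for \<omega>
  have A: "Measurable.pred (Fs ?s) A"
    unfolding A_def [abs_def] pred_def
    using gain_measurable(1)[OF reg Q i(1) a] gain_measurable(1)[OF reg Q i(1) b]
    by (intro borel_measurable_le)
  define c where "c \<omega> = (if A \<omega> then a \<omega> else b \<omega>)" for \<omega>
  have "c \<in> strats"
    unfolding c_def [abs_def]
    by (rule strats_paste[OF as bs measurable_Fs_mono[OF A hstD[OF s] hstD[OF as] afterD(2)[OF a]]
        measurable_Fs_mono[OF A hstD[OF s] hstD[OF bs] afterD(2)[OF b]]])
  moreover have "AE \<omega> in M. ?s \<omega> \<le> c \<omega>"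
    using afterD(2)[OF a] afterD(2)[OF b] by eventually_elim (simp add: c_def)
  ultimately have c: "c \<in> after ?s" by (rule afterI)
  have sup: "sup \<sigma> ?s \<in> after ?s" if "\<sigma> \<in> strats" for \<sigma>
    by (rule afterI[OF strats_sup[OF that s]]) simp
  \<comment> \<open>The rewards are only given for continuations \<open>\<sigma> \<ge> ?s\<close>. Truncation extends them to all strategies:
    on \<open>{?s \<le> \<sigma>}\<close> what is known at \<open>sup \<sigma> ?s\<close> is known at \<open>\<sigma>\<close>.\<close>
  define \<xi> where "\<xi> \<sigma> \<omega> = (if sup \<sigma> ?s \<omega> = \<sigma> \<omega> then reward (Q @ [sup \<sigma> ?s]) \<omega> else 0)" for \<sigma> \<omega>
  have \<xi>: "\<xi> \<sigma> \<in> Lp M p (Fs \<sigma>)" if \<sigma>: "\<sigma> \<in> strats" for \<sigma>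
    unfolding \<xi>_def [abs_def]
    by (rule Lp_on_eq[OF hstD[OF \<sigma>] hstD[OF strats_sup[OF \<sigma> s]] regular_append_Lp[OF reg Q i(1) sup[OF \<sigma>]]])
  have adm: "admissible M T F \<theta> \<xi>"
    unfolding admissible_def
  proof (intro conjI ballI)
    fix \<sigma> assume \<sigma>: "\<sigma> \<in> strats"
    show "\<xi> \<sigma> \<in> borel_measurable (Fs \<sigma>)" using \<xi>[OF \<sigma>] by (simp add: Lp_def)
    fix \<sigma>' assume \<sigma>': "\<sigma>' \<in> strats"
    show "AE \<omega> in M. \<sigma> \<omega> = \<sigma>' \<omega> \<longrightarrow> \<xi> \<sigma> \<omega> = \<xi> \<sigma>' \<omega>"
      using regular_append_cong[OF reg Q Q i(1) sup[OF \<sigma>] sup[OF \<sigma>']]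
      by eventually_elim (simp add: \<xi>_def)
  qed
  have int: "p_integrable M p strats \<xi>"
    unfolding p_integrable_def using \<xi> Lp_Fs_iff[OF hstD] by blast
  have gain: "AE \<omega> in M. \<rho> ?s \<sigma> (\<xi> \<sigma>) \<omega> = gain Q \<sigma> \<omega>" if \<sigma>: "\<sigma> \<in> after ?s" for \<sigma>
    unfolding gain_def
  proof (rule rho_cong[OF s afterD(1)[OF \<sigma>] \<xi>[OF afterD(1)[OF \<sigma>]] regular_append_Lp[OF reg Q i(1) \<sigma>]])
    show "AE \<omega> in M. \<xi> \<sigma> \<omega> = reward (Q @ [\<sigma>]) \<omega>"
      using regular_append_cong[OF reg Q Q i(1) sup[OF afterD(1)[OF \<sigma>]] \<sigma>] afterD(2)[OF \<sigma>]
      by eventually_elim (simp add: \<xi>_def sup_real_def max_def split: if_splits)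
  qed
  have law: "AE \<omega> in M. P \<omega> \<longrightarrow> gain Q \<sigma> \<omega> = gain Q c \<omega>"
    if P: "Measurable.pred (Fs ?s) P" and \<sigma>: "\<sigma> \<in> after ?s" and eq: "\<And>\<omega>. P \<omega> \<Longrightarrow> \<sigma> \<omega> = c \<omega>" for P \<sigma>
  proof -
    have "{\<omega>\<in>space M. P \<omega>} \<in> sets (Fs ?s)" using P by (simp add: pred_def)
    then have "AE \<omega> in M. \<omega> \<in> {\<omega>\<in>space M. P \<omega>} \<longrightarrow> \<rho> ?s \<sigma> (\<xi> \<sigma>) \<omega> = \<rho> ?s c (\<xi> c) \<omega>"
      by (rule zero_one_law[OF adm int s _ \<sigma> c]) (simp add: eq)
    with gain[OF \<sigma>] gain[OF c] AE_space show ?thesis by eventually_elim simp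
  qed
  have "AE \<omega> in M. A \<omega> \<longrightarrow> gain Q a \<omega> = gain Q c \<omega>"
    by (rule law[OF A a]) (simp add: c_def)
  moreover have "AE \<omega> in M. \<not> A \<omega> \<longrightarrow> gain Q b \<omega> = gain Q c \<omega>"
    by (rule law[OF pred_intros_logic(2)[OF A] b]) (simp add: c_def)
  ultimately have "AE \<omega> in M. max (gain Q a \<omega>) (gain Q b \<omega>) \<le> gain Q c \<omega>"
  proof eventually_elim
    case (elim \<omega>)
    then show ?case by (cases "A \<omega>") (auto simp: A_def)
  qed
  then show ?thesis using c by blast
qed

section \<open>Comparison with the value function\<close>

lemma order_stats_Ord: "\<tau>s \<in> tuples d (after S) \<Longrightarrow> order_stats \<tau>s \<in> Ord d"
  by (rule order_stats_ordered)

lemma latest_after: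
  assumes "\<tau>s \<in> tuples d (after S)"
  shows "latest \<tau>s \<in> after S" "latest \<tau>s \<in> strats"
proof -
  have d1: "1 \<le> d" using d2 by simp
  note Q = order_stats_Ord[OF assms]
  note l = latest_ordered[OF Q d1, unfolded latest_order_stats]
  show "latest \<tau>s \<in> strats" by (rule l)
  then show "latest \<tau>s \<in> after S"
  proof (rule afterI)
    show "AE \<omega> in M. S \<omega> \<le> latest \<tau>s \<omega>"
      using l(1) afterD(2)[OF ordered_last(1)[OF Q d1]] by eventually_elim simp
  qed
qed

lemma rho_psi_order_stats:
  assumes \<tau>s: "\<tau>s \<in> tuples d (after S)"
  shows "AE \<omega> in M. \<rho> S (latest \<tau>s) (\<psi> \<tau>s) \<omega> =
    \<rho> S (last (order_stats \<tau>s)) (reward (order_stats \<tau>s)) \<omega>"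
proof -
  let ?Q = "order_stats \<tau>s"
  have d1: "1 \<le> d" using d2 by simp
  note Q = order_stats_Ord[OF \<tau>s]
  have t: "\<tau>s \<in> tuples d strats" "?Q \<in> tuples d strats"
    using \<tau>s Ord_tuples[OF Q] tuples_after by blast+
  note l = latest_ordered[OF Q d1, unfolded latest_order_stats]
  have \<psi>Q: "\<psi> ?Q \<in> Lp M p (Fs (latest \<tau>s))"
    using psi_Lp[OF t(2)] l(2) by (simp add: latest_order_stats)
  have "AE \<omega> in M. \<rho> S (latest \<tau>s) (\<psi> \<tau>s) \<omega> = \<rho> S (latest \<tau>s) (\<psi> ?Q) \<omega>"
    by (rule rho_cong[OF S l(2) psi_Lp[OF t(1) l(2)] \<psi>Q symmetric_order_stats[OF sym adm t]])
  moreover have "AE \<omega> in M. \<rho> S (latest \<tau>s) (\<psi> ?Q) \<omega> = \<rho> S (last ?Q) (\<psi> ?Q) \<omega>"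
    by (rule rho_cong_time[OF S latest_after(1)[OF \<tau>s] ordered_last(2)[OF Q d1] l(1) \<psi>Q])
  ultimately show ?thesis
    by eventually_elim (use Ord_length[OF Q] in \<open>simp add: reward_def\<close>)
qed

lemma is_ess_SUP_value:
  "is_ess_SUP M (tuples d (after S)) (\<lambda>\<tau>s. \<rho> S (latest \<tau>s) (\<psi> \<tau>s)) (value_fun M strats \<rho> d \<psi> S)"
  unfolding value_fun_def
proof (rule is_ess_SUP_ess_SUP)
  fix \<tau>s assume \<tau>s: "\<tau>s \<in> tuples d (after S)"
  then have "\<tau>s \<in> tuples d strats" using tuples_after by blast
  from maps_Lp[OF S latest_after(2)[OF \<tau>s] psi_Lp[OF this latest_after(2)[OF \<tau>s]]]
  show "\<rho> S (latest \<tau>s) (\<psi> \<tau>s) \<in> borel_measurable M"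
    using Lp_Fs_iff[OF hstD[OF S]] by (simp add: Lp_def)
qed

lemma rho_reward_step:
  assumes Q: "Q \<in> Ord i" and i: "1 \<le> i" "i < d" and \<tau>: "\<tau> \<in> after (last Q)"
  shows "AE \<omega> in M. \<rho> S (last Q) (gain Q \<tau>) \<omega> = \<rho> S \<tau> (reward (Q @ [\<tau>])) \<omega>"
  unfolding gain_def
proof (rule consistency[OF S ordered_last(2)[OF Q i(1)] afterD(1)[OF \<tau>] afterD(2)[OF ordered_last(1)[OF Q i(1)]] afterD(2)[OF \<tau>]])
  have "regular (Suc i)" using i by (intro regular) auto
  then show "reward (Q @ [\<tau>]) \<in> Lp M p (Fs \<tau>)" by (rule regular_append_Lp[OF _ Q i(1) \<tau>])
qed

text \<open>Backward induction on the length. The reward of \<open>Q\<close> is the increasing limit of the gains of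
  continuations \<open>t n\<close>; by the Fatou property its evaluation at \<open>S\<close> is bounded through evaluations of the
  gains, and by consistency these are evaluations of rewards of longer tuples.\<close>

lemma rho_reward_le_value:
  assumes "i \<le> d" "1 \<le> i" "Q \<in> Ord i"
  shows "AE \<omega> in M. ereal (\<rho> S (last Q) (reward Q) \<omega>) \<le> value_fun M strats \<rho> d \<psi> S \<omega>"
  using assms
proof (induction i arbitrary: Q rule: inc_induct)
  case base
  note Q = base(2)
  have t: "Q \<in> tuples d (after S)" by (rule Ord_tuples[OF Q])
  have "AE \<omega> in M. ereal (\<rho> S (latest Q) (\<psi> Q) \<omega>) \<le> value_fun M strats \<rho> d \<psi> S \<omega>"
    using is_ess_SUP_value t by (simp add: is_ess_SUP_def)
  moreover have "AE \<omega> in M. \<rho> S (latest Q) (\<psi> Q) \<omega> = \<rho> S (last Q) (\<psi> Q) \<omega>"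
    by (rule rho_cong_time[OF S latest_after(1)[OF t] ordered_last(2)[OF Q base(1)]
          latest_ordered(1)[OF Q base(1)] psi_Lp[OF subsetD[OF tuples_after t] latest_after(2)[OF t]]])
  ultimately show ?case
    by eventually_elim (use Ord_length[OF Q] in \<open>simp add: reward_def\<close>)
next
  case (step i)
  note Q = step.prems(2) and i = step.prems(1) step.hyps(2)
  have reg: "regular (Suc i)" "regular i" using i by (auto intro!: regular)
  note s = ordered_last[OF Q i(1)]
  have ne: "after (last Q) \<noteq> {}" using after_refl[OF s(2)] by blast
  obtain t where t: "\<And>n. t n \<in> after (last Q)"
      "\<And>n. AE \<omega> in M. gain Q (t n) \<omega> \<le> gain Q (t (Suc n)) \<omega>"
      "AE \<omega> in M. (\<lambda>n. ereal (gain Q (t n) \<omega>)) \<longlonglongrightarrow> ess_SUP M (after (last Q)) (gain Q) \<omega>"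
    by (rule directed_ess_SUP_sequence[OF ne, of "gain Q"])
      (use gain_measurable(2)[OF reg(1) Q i(1)] gain_directed[OF Q i] in blast)+
  have "AE \<omega> in M. (\<lambda>n. gain Q (t n) \<omega>) \<longlonglongrightarrow> reward Q \<omega>"
    using t(3) phi_finite[OF Q i] unfolding phi_eq_ess_SUP_gain[OF Q i(2), symmetric]
    by eventually_elim simp
  then have "AE \<omega> in M. ereal (\<rho> S (last Q) (reward Q) \<omega>)
      \<le> liminf (\<lambda>n. ereal (\<rho> S (last Q) (gain Q (t n)) \<omega>))"
    by (rule monotone_fatou[where \<eta>s = "\<lambda>n. gain Q (t n)", OF S s(2) gain_Lp[OF reg(1) Q i(1) t(1)] t(2) regular_Lp[OF reg(2) Q]])
  moreover have "AE \<omega> in M. \<forall>n. ereal (\<rho> S (last Q) (gain Q (t n)) \<omega>) \<le> value_fun M strats \<rho> d \<psi> S \<omega>"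
    unfolding AE_all_countable
  proof
    fix n
    have "AE \<omega> in M. ereal (\<rho> S (last (Q @ [t n])) (reward (Q @ [t n])) \<omega>) \<le> value_fun M strats \<rho> d \<psi> S \<omega>"
      by (rule step.IH[OF _ ordered_append[OF Q i(1) t(1)]]) simp
    with rho_reward_step[OF Q i t(1)[of n]]
    show "AE \<omega> in M. ereal (\<rho> S (last Q) (gain Q (t n)) \<omega>) \<le> value_fun M strats \<rho> d \<psi> S \<omega>"
      by eventually_elim simp
  qed
  ultimately show ?case
  proof eventually_elim
    case (elim \<omega>)
    have "liminf (\<lambda>n. ereal (\<rho> S (last Q) (gain Q (t n)) \<omega>)) \<le> value_fun M strats \<rho> d \<psi> S \<omega>"
      using elim(2) by (intro Liminf_le) auto
    with elim(1) show ?case by (rule order_trans)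
  qed
qed

text \<open>Dropping the last time replaces a gain by the supremum of all gains, which can only increase the
  evaluation at \<open>S\<close>.\<close>

lemma rho_reward_le_first:
  assumes "1 \<le> i" "i \<le> d" "Q \<in> Ord i"
  shows "AE \<omega> in M. \<rho> S (last Q) (reward Q) \<omega> \<le> \<rho> S (hd Q) (reward [hd Q]) \<omega>"
  using assms
proof (induction Q arbitrary: i rule: rev_induct)
  case Nil
  then show ?case using Ord_length[OF Nil(3)] by simp
next
  case (snoc \<tau> Q)
  obtain k where k: "i = Suc k" "length Q = k" using Ord_length[OF snoc.prems(3)] by auto
  show ?case
  proof (cases "Q = []")
    case False
    then have k1: "1 \<le> k" "k < d" using k snoc.prems(2) by (auto simp: Suc_le_eq)
    have Q: "Q \<in> Ord k" and \<tau>: "\<tau> \<in> after (last Q)"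
      using ordered_appendD snoc.prems(3) k(1) False by blast+
    have reg: "regular (Suc k)" "regular k" using k1 by (auto intro!: regular)
    have "AE \<omega> in M. gain Q \<tau> \<omega> \<le> \<phi> Q \<omega>"
      using is_ess_SUP_phi[OF reg(1) Q k1] \<tau> by (simp add: is_ess_SUP_def)
    with phi_finite[OF Q k1] have "AE \<omega> in M. gain Q \<tau> \<omega> \<le> reward Q \<omega>" by eventually_elim simp
    then have "AE \<omega> in M. \<rho> S (last Q) (gain Q \<tau>) \<omega> \<le> \<rho> S (last Q) (reward Q) \<omega>"
      by (rule monotonicity[OF S ordered_last(2)[OF Q k1(1)] gain_Lp[OF reg(1) Q k1(1) \<tau>] regular_Lp[OF reg(2) Q]])
    moreover have "AE \<omega> in M. \<rho> S (last Q) (reward Q) \<omega> \<le> \<rho> S (hd Q) (reward [hd Q]) \<omega>"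
      using k1 by (intro snoc.IH[OF _ _ Q]) auto
    ultimately show ?thesis
      using rho_reward_step[OF Q k1 \<tau>] by eventually_elim (simp add: False)
  qed simp
qed

lemma value_eq_ess_SUP_reward:
  "AE \<omega> in M. value_fun M strats \<rho> d \<psi> S \<omega> = ess_SUP M (after S) (\<lambda>\<tau>. \<rho> S \<tau> (reward [\<tau>])) \<omega>"
proof -
  let ?V = "value_fun M strats \<rho> d \<psi> S"
  let ?W = "ess_SUP M (after S) (\<lambda>\<tau>. \<rho> S \<tau> (reward [\<tau>]))"
  have d1: "1 \<le> d" using d2 by simp
  have W: "is_ess_SUP M (after S) (\<lambda>\<tau>. \<rho> S \<tau> (reward [\<tau>])) ?W"
  proof (rule is_ess_SUP_ess_SUP)
    fix \<tau> assume \<tau>: "\<tau> \<in> after S"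
    have "reward [\<tau>] \<in> Lp M p (Fs \<tau>)"
      using regular_Lp[OF regular[OF order_refl d1] ordered_singleton[OF \<tau>]] by simp
    from maps_Lp[OF S afterD(1)[OF \<tau>] this] show "\<rho> S \<tau> (reward [\<tau>]) \<in> borel_measurable M"
      using Lp_Fs_iff[OF hstD[OF S]] by (simp add: Lp_def)
  qed
  have "AE \<omega> in M. ereal (\<rho> S (latest \<tau>s) (\<psi> \<tau>s) \<omega>) \<le> ?W \<omega>" if \<tau>s: "\<tau>s \<in> tuples d (after S)" for \<tau>s
  proof -
    let ?Q = "order_stats \<tau>s"
    note Q = order_stats_Ord[OF \<tau>s]
    have "hd ?Q \<in> after S"
      using Ord_tuples[OF Q] d1 by (cases ?Q) (auto simp: tuples_def)
    then have "AE \<omega> in M. ereal (\<rho> S (hd ?Q) (reward [hd ?Q]) \<omega>) \<le> ?W \<omega>"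
      using W by (simp add: is_ess_SUP_def)
    with rho_psi_order_stats[OF \<tau>s] rho_reward_le_first[OF d1 order_refl Q]
    show ?thesis
    proof eventually_elim
      case (elim \<omega>)
      have "ereal (\<rho> S (latest \<tau>s) (\<psi> \<tau>s) \<omega>) \<le> ereal (\<rho> S (hd ?Q) (reward [hd ?Q]) \<omega>)"
        using elim(1,2) by simp
      then show ?case using elim(3) by (rule order_trans)
    qed
  qed
  then have "AE \<omega> in M. ?V \<omega> \<le> ?W \<omega>"
    using is_ess_SUP_value W unfolding is_ess_SUP_def by blast
  moreover have "AE \<omega> in M. ereal (\<rho> S \<tau> (reward [\<tau>]) \<omega>) \<le> ?V \<omega>" if \<tau>: "\<tau> \<in> after S" for \<tau>
    using rho_reward_le_value[OF d1 order_refl ordered_singleton[OF \<tau>]] by simp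
  then have "AE \<omega> in M. ?W \<omega> \<le> ?V \<omega>"
    using is_ess_SUP_value W unfolding is_ess_SUP_def by blast
  ultimately show ?thesis by eventually_elim (rule antisym)
qed

end

theorem proposition5:
  fixes M :: "'a measure"
    and T :: real
    and F :: "real \<Rightarrow> 'a measure"
    and \<theta> :: "nat \<Rightarrow> 'a \<Rightarrow> real"
    and p :: ennreal
    and d :: nat
    and \<rho> :: "('a \<Rightarrow> real) \<Rightarrow> ('a \<Rightarrow> real) \<Rightarrow> ('a \<Rightarrow> real) \<Rightarrow> ('a \<Rightarrow> real)"
    and \<psi> :: "('a \<Rightarrow> real) list \<Rightarrow> ('a \<Rightarrow> real)"
    and \<Theta> :: "('a \<Rightarrow> real) set"
    and S :: "'a \<Rightarrow> real"
  assumes "bermudan_operators M T F \<theta> p d \<rho>"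
    and "\<Theta> = strategies M T F \<theta>"
    and "d \<ge> 2"
    and "symmetric_family M \<Theta> d \<psi>"
    and "multi_admissible M T F \<theta> d \<psi>"
    and "p_integrable M p (tuples d \<Theta>) \<psi>"
    and "\<And>R. R \<in> \<Theta> \<Longrightarrow> in_Lp_ereal M p (value_fun M \<Theta> \<rho> d \<psi> R)"
    and "S \<in> \<Theta>"
    and "\<And>i Ss. i \<in> {1..d - 1} \<Longrightarrow> Ss \<in> ordered_tuples M i (strategies_from M \<Theta> S) \<Longrightarrow>
           in_Lp_ereal M p (phi M \<Theta> \<rho> d \<psi> Ss)"
  shows "AE \<omega> in M. value_fun M \<Theta> \<rho> d \<psi> S \<omega> =
           ess_SUP M (strategies_from M \<Theta> S)
             (\<lambda>\<tau>. \<rho> S \<tau> (\<lambda>\<omega>. real_of_ereal (phi M \<Theta> \<rho> d \<psi> [\<tau>] \<omega>))) \<omega>"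
proof -
  interpret multiple_stopping M T F \<theta> p d \<rho> \<psi> S
    using assms by (simp add: multiple_stopping_def multiple_stopping_axioms_def)
  have "reward [\<tau>] = (\<lambda>\<omega>. real_of_ereal (phi M \<Theta> \<rho> d \<psi> [\<tau>] \<omega>))" for \<tau>
    using assms(2,3) by (simp add: reward_def)
  with value_eq_ess_SUP_reward show ?thesis using assms(2) by simp
qed

end
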